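(* Let $R$ be a ring and assume that the binary relation $\preccurlyeq$ on $R\text{-}\mathrm{Mod}$ is E-nice. Suppose $\mathbf K\subseteq R\text{-}\mathrm{Mod}$ satisfies: (1) $\mathcal K=(\mathbf K,\preccurlyeq)$ (with $\preccurlyeq$ restricted to $\mathbf K$) is an AEC; (2) $\mathbf K$ is closed under $R$-submodules, i.e. if $A\leq B$ and $B\in\mathbf K$, then $A\in\mathbf K$. Then $\mathcal K$ is stable.
   Context: Rings are associative with identity, modules are left modules, $\operatorname{card}(R)$ is the cardinality of $R$. $R\text{-}\mathrm{Mod}$ is the class of all $R$-modules, viewed as structures in the language $\tau_R=\{0,+,-\}\cup\{r\cdot\mid r\in R\}$. $A\leq B$ means submodule. AEC: a pair $\mathcal K=(\mathbf K,\preccurlyeq)$, with $\mathbf K$ a class of $L$-structures and $\preccurlyeq$ a binary relation on $\mathbf K$, such that: (i) $\mathbf K$ and $\preccurlyeq$ are closed under isomorphisms; (ii) $A\preccurlyeq B$ implies $A$ is a substructure of $B$; (iii) $\preccurlyeq$ is a partial order; (iv) if $(A_i)_{i<\delta}$ ($\delta$ limit) is an increasing continuous $\preccurlyeq$-chain in $\mathbf K$, then $A=\bigcup_{i<\delta}A_i\in\mathbf K$, $A_j\preccurlyeq A$ for all $j<\delta$, and if $A_i\preccurlyeq B\in\mathbf K$ for all $i<\delta$ then $A\preccurlyeq B$; (v) if $A\preccurlyeq C$, $B\preccurlyeq C$ and $A$ is a substructure of $B$ then $A\preccurlyeq B$; (vi) there is a cardinal $\lambda\geq|L|+\aleph_0$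 such that for all $B\in\mathbf K$, $X\subseteq B$ there is $A\in\mathbf K$ with $X\subseteq A\preccurlyeq B$ and $|A|\leq|X|+\lambda$; the least such $\lambda$ is $\mathrm{LS}(\mathcal K)$. An embedding $f:A\to B$ is strong if $f(A)\preccurlyeq B$. E-nice: a binary relation $\preccurlyeq$ on $R\text{-}\mathrm{Mod}$ is E-nice if there are an infinite cardinal $\lambda\geq\operatorname{card}(R)$ and a set $\Sigma$ of formulas, each of the form $\exists(v_\ell)_{\ell<\lambda}\bigwedge_{i<\lambda}\big(\sum_{\ell<\lambda}r_{i,\ell}v_\ell+\sum_{j<n}q_{i,j}x_j=0\big)$ with $n<\omega$, free variables $\bar x=(x_0,\dots,x_{n-1})$, $r_{i,\ell},q_{i,j}\in R$, and for each $i<\lambda$ only finitely many $r_{i,\ell}$ nonzero, such that $\preccurlyeq\,=\,\leq_\Sigma$. Here $A\leq_\Sigma B$ iff $A\leq B$ and for all $\varphi(\bar x)\in\Sigma$, $\bar a\in A^{|\bar x|}$: $A\models\varphi(\bar a)\Leftrightarrow B\models\varphi(\bar a)$. (It is not assumed that $(R\text{-}\mathrm{Mod},\preccurlyeq)$ itself is an AEC.) Types and stability: for $\ell\in\{1,2\}$, $A_\ell\in\mathbf K$, $X_\ell\subseteq A_\ell$, $\bar b_\ell$ a sequence from $A_\ell$, put $(\bar b_1,X_1,A_1)\,E^{\mathrm{at}}_{\mathcal K}\,(\bar b_2,X_2,A_2)$ iff $X_1=X_2=:X$ and there are $A_*\in\mathbf K$ and strong embeddings $f_\ell:A_\ell\to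 A_*$ with $f_1\restriction X=f_2\restriction X=\mathrm{id}_X$ and $f_1(\bar b_1)=f_2(\bar b_2)$. $E_{\mathcal K}$ is the transitive closure, and $\mathbf{gtp}_{\mathcal K}(\bar b/X;A)$ is the $E_{\mathcal K}$-class of $(\bar b,X,A)$. $\mathcal S_{\mathcal K}(A)=\{\mathbf{gtp}_{\mathcal K}(b/A;B)\mid A\preccurlyeq B\in\mathbf K,\ b\in B\}$. For $\mu\geq\mathrm{LS}(\mathcal K)$, $\mathcal K$ is $\mu$-stable if $|\mathcal S_{\mathcal K}(A)|\leq\mu$ for every $A\in\mathbf K$ with $|A|=\mu$. $\mathcal K$ is stable if it is $\mu$-stable for unboundedly many cardinals $\mu$. *)

theory Defs
  imports "HOL-Algebra.FiniteProduct"
begin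

unbundle cardinal_syntax

section \<open>The universe of sets\<close>

text \<open>
  Abstract elementary classes are proper classes, and stability quantifies over all cardinals.
  Set theory is therefore played inside a type \<open>'u\<close> of inaccessible cardinality, i.e. a type
  with as many elements as a universe of sets (an initial segment of the cumulative hierarchy
  that is closed under all set-theoretic operations).  The \<^emph>\<open>sets\<close> of the universe are
  the small subsets of \<open>'u\<close>, \<^emph>\<open>classes\<close> of structures are arbitrary HOL sets of
  structures with small carrier, and the \<^emph>\<open>cardinals\<close> of the universe are, following
  the library, cardinal well-orders on subsets of \<open>'u\<close> that are smaller than \<open>'u\<close>
  (equal cardinals correspond to \<open>=o\<close>).
\<close>

definition universe :: "'u itself \<Rightarrow> bool" where
  "universe _ \<longleftrightarrow>
     natLeq <o |UNIV :: 'u set| \<and>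
     regularCard |UNIV :: 'u set| \<and>
     (\<forall>X :: 'u set. |X| <o |UNIV :: 'u set| \<longrightarrow> |Pow X| <o |UNIV :: 'u set| )"

definition small :: "'u set \<Rightarrow> bool" where
  "small X \<longleftrightarrow> |X| <o |UNIV :: 'u set|"

definition small_cardinal :: "'u rel \<Rightarrow> bool" where
  "small_cardinal \<kappa> \<longleftrightarrow> Card_order \<kappa> \<and> \<kappa> <o |UNIV :: 'u set|"


section \<open>Languages and structures\<close>

record ('f, 'p) language =
  fsyms :: "'f set"
  psyms :: "'p set"
  farity :: "'f \<Rightarrow> nat"
  parity :: "'p \<Rightarrow> nat"

record ('f, 'p, 'u) str =
  carr :: "'u set"
  fn :: "'f \<Rightarrow> 'u list \<Rightarrow> 'u"
  rl :: "'p \<Rightarrow> 'u list \<Rightarrow> bool"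

text \<open>
  Interpretations have a fixed default value outside their proper domain, so that HOL equality of
  structures is genuine equality (this matters for antisymmetry of strong submodule relations).
\<close>

definition is_str :: "('f, 'p) language \<Rightarrow> ('f, 'p, 'u) str \<Rightarrow> bool" where
  "is_str L A \<longleftrightarrow>
     carr A \<noteq> {} \<and> small (carr A) \<and>
     (\<forall>s xs. if s \<in> fsyms L \<and> length xs = farity L s \<and> set xs \<subseteq> carr A
             then fn A s xs \<in> carr A else fn A s xs = undefined) \<and>
     (\<forall>p xs. rl A p xs \<longrightarrow> p \<in> psyms L \<and> length xs = parity L p \<and> set xs \<subseteq> carr A)"

definition induced :: "('f, 'p, 'u) str \<Rightarrow> 'u set \<Rightarrow> ('f, 'p, 'u) str" where
  "induced B S =
     \<lparr>carr = S,
      fn = (\<lambda>s xs. if set xs \<subseteq> S then fn B s xs else undefined),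
      rl = (\<lambda>p xs. set xs \<subseteq> S \<and> rl B p xs)\<rparr>"

definition substructure ::
  "('f, 'p) language \<Rightarrow> ('f, 'p, 'u) str \<Rightarrow> ('f, 'p, 'u) str \<Rightarrow> bool" where
  "substructure L A B \<longleftrightarrow>
     is_str L A \<and> is_str L B \<and> carr A \<subseteq> carr B \<and> A = induced B (carr A)"

definition embedding ::
  "('f, 'p) language \<Rightarrow> ('u \<Rightarrow> 'u) \<Rightarrow> ('f, 'p, 'u) str \<Rightarrow> ('f, 'p, 'u) str \<Rightarrow> bool" where
  "embedding L f A B \<longleftrightarrow>
     is_str L A \<and> is_str L B \<and> f ` carr A \<subseteq> carr B \<and> inj_on f (carr A) \<and>
     (\<forall>s\<in>fsyms L. \<forall>xs. length xs = farity L s \<and> set xs \<subseteq> carr A \<longrightarrow>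
        f (fn A s xs) = fn B s (map f xs)) \<and>
     (\<forall>p\<in>psyms L. \<forall>xs. length xs = parity L p \<and> set xs \<subseteq> carr A \<longrightarrow>
        (rl A p xs \<longleftrightarrow> rl B p (map f xs)))"

definition isomorphism ::
  "('f, 'p) language \<Rightarrow> ('u \<Rightarrow> 'u) \<Rightarrow> ('f, 'p, 'u) str \<Rightarrow> ('f, 'p, 'u) str \<Rightarrow> bool" where
  "isomorphism L f A B \<longleftrightarrow> embedding L f A B \<and> f ` carr A = carr B"

text \<open>The union of a family that is directed under the substructure relation.\<close>

definition Union_str :: "'i set \<Rightarrow> ('i \<Rightarrow> ('f, 'p, 'u) str) \<Rightarrow> ('f, 'p, 'u) str" where
  "Union_str I A =
     \<lparr>carr = (\<Union>i\<in>I. carr (A i)),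
      fn = (\<lambda>s xs. if \<exists>i\<in>I. set xs \<subseteq> carr (A i)
                   then fn (A (SOME i. i \<in> I \<and> set xs \<subseteq> carr (A i))) s xs
                   else undefined),
      rl = (\<lambda>p xs. \<exists>i\<in>I. rl (A i) p xs)\<rparr>"


section \<open>Abstract elementary classes\<close>

definition no_last :: "'i rel \<Rightarrow> 'i set \<Rightarrow> bool" where
  "no_last d S \<longleftrightarrow> S \<noteq> {} \<and> (\<forall>i\<in>S. \<exists>j\<in>S. (i, j) \<in> d \<and> i \<noteq> j)"

text \<open>
  A limit ordinal \<open>\<delta>\<close> is given by a small well-order \<open>d\<close> on a subset of \<open>'u\<close>; the
  ordinals below \<open>\<delta>\<close> are the elements of \<open>Field d\<close>.
\<close>

definition limit_ordinal :: "'u rel \<Rightarrow> bool" where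
  "limit_ordinal d \<longleftrightarrow> Well_order d \<and> small (Field d) \<and> no_last d (Field d)"

definition continuous_chain ::
  "('f, 'p, 'u) str set \<Rightarrow> (('f, 'p, 'u) str \<Rightarrow> ('f, 'p, 'u) str \<Rightarrow> bool) \<Rightarrow>
   'u rel \<Rightarrow> ('u \<Rightarrow> ('f, 'p, 'u) str) \<Rightarrow> bool" where
  "continuous_chain K prec d A \<longleftrightarrow>
     (\<forall>i\<in>Field d. A i \<in> K) \<and>
     (\<forall>i j. (i, j) \<in> d \<longrightarrow> prec (A i) (A j)) \<and>
     (\<forall>i\<in>Field d. no_last d (underS d i) \<longrightarrow> A i = Union_str (underS d i) A)"

definition LS_bound ::
  "('f, 'p) language \<Rightarrow> ('f, 'p, 'u) str set \<Rightarrow>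
   (('f, 'p, 'u) str \<Rightarrow> ('f, 'p, 'u) str \<Rightarrow> bool) \<Rightarrow> 'u rel \<Rightarrow> bool" where
  "LS_bound L K prec lam \<longleftrightarrow>
     small_cardinal lam \<and> |fsyms L <+> psyms L| +c natLeq \<le>o lam \<and>
     (\<forall>B\<in>K. \<forall>X\<subseteq>carr B. \<exists>A\<in>K. X \<subseteq> carr A \<and> prec A B \<and> |carr A| \<le>o |X| +c lam)"

definition LS ::
  "('f, 'p) language \<Rightarrow> ('f, 'p, 'u) str set \<Rightarrow>
   (('f, 'p, 'u) str \<Rightarrow> ('f, 'p, 'u) str \<Rightarrow> bool) \<Rightarrow> 'u rel" where
  "LS L K prec = (SOME lam. LS_bound L K prec lam \<and> (\<forall>\<kappa>. LS_bound L K prec \<kappa> \<longrightarrow> lam \<le>o \<kappa>))"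

locale aec =
  fixes L :: "('f, 'p) language"
    and K :: "('f, 'p, 'u) str set"
    and prec :: "('f, 'p, 'u) str \<Rightarrow> ('f, 'p, 'u) str \<Rightarrow> bool"
  assumes K_str: "A \<in> K \<Longrightarrow> is_str L A"
    and prec_K: "prec A B \<Longrightarrow> A \<in> K \<and> B \<in> K"
    and K_iso: "A \<in> K \<Longrightarrow> isomorphism L f A B \<Longrightarrow> B \<in> K"
    and prec_iso: "prec A B \<Longrightarrow> isomorphism L f B B' \<Longrightarrow> prec (induced B' (f ` carr A)) B'"
    and prec_substructure: "prec A B \<Longrightarrow> substructure L A B"
    and prec_refl: "A \<in> K \<Longrightarrow> prec A A"
    and prec_antisym: "prec A B \<Longrightarrow> prec B A \<Longrightarrow> A = B"
    and prec_trans: "prec A B \<Longrightarrow> prec B C \<Longrightarrow> prec A C"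
    and Union_in_K:
      "limit_ordinal d \<Longrightarrow> continuous_chain K prec d M \<Longrightarrow> Union_str (Field d) M \<in> K"
    and prec_Union:
      "limit_ordinal d \<Longrightarrow> continuous_chain K prec d M \<Longrightarrow> j \<in> Field d \<Longrightarrow>
       prec (M j) (Union_str (Field d) M)"
    and Union_prec:
      "limit_ordinal d \<Longrightarrow> continuous_chain K prec d M \<Longrightarrow> B \<in> K \<Longrightarrow>
       (\<And>i. i \<in> Field d \<Longrightarrow> prec (M i) B) \<Longrightarrow> prec (Union_str (Field d) M) B"
    and coherence: "prec A C \<Longrightarrow> prec B C \<Longrightarrow> substructure L A B \<Longrightarrow> prec A B"
    and Loewenheim_Skolem: "\<exists>lam. LS_bound L K prec lam"

definition strong_embedding ::
  "('f, 'p) language \<Rightarrow> (('f, 'p, 'u) str \<Rightarrow> ('f, 'p, 'u) str \<Rightarrow> bool) \<Rightarrow>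
   ('u \<Rightarrow> 'u) \<Rightarrow> ('f, 'p, 'u) str \<Rightarrow> ('f, 'p, 'u) str \<Rightarrow> bool" where
  "strong_embedding L prec f A B \<longleftrightarrow> embedding L f A B \<and> prec (induced B (f ` carr A)) B"


section \<open>Galois types and stability\<close>

text \<open>
  Sequences are families indexed by an arbitrary type \<open>'i\<close>; a single element is a family
  indexed by \<open>unit\<close>.  The atomic relation only relates sequences with the same index set.
\<close>

type_synonym ('i, 'f, 'p, 'u) triple = "('i \<Rightarrow> 'u) \<times> 'u set \<times> ('f, 'p, 'u) str"

definition E_at ::
  "('f, 'p) language \<Rightarrow> ('f, 'p, 'u) str set \<Rightarrow>
   (('f, 'p, 'u) str \<Rightarrow> ('f, 'p, 'u) str \<Rightarrow> bool) \<Rightarrow>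
   ('i, 'f, 'p, 'u) triple \<Rightarrow> ('i, 'f, 'p, 'u) triple \<Rightarrow> bool" where
  "E_at L K prec = (\<lambda>(b1, X1, A1) (b2, X2, A2).
     A1 \<in> K \<and> A2 \<in> K \<and> X1 \<subseteq> carr A1 \<and> X2 \<subseteq> carr A2 \<and>
     range b1 \<subseteq> carr A1 \<and> range b2 \<subseteq> carr A2 \<and> X1 = X2 \<and>
     (\<exists>C\<in>K. \<exists>f1 f2. strong_embedding L prec f1 A1 C \<and> strong_embedding L prec f2 A2 C \<and>
        (\<forall>x\<in>X1. f1 x = x \<and> f2 x = x) \<and> f1 \<circ> b1 = f2 \<circ> b2))"

definition gtp ::
  "('f, 'p) language \<Rightarrow> ('f, 'p, 'u) str set \<Rightarrow>
   (('f, 'p, 'u) str \<Rightarrow> ('f, 'p, 'u) str \<Rightarrow> bool) \<Rightarrow>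
   ('i \<Rightarrow> 'u) \<Rightarrow> 'u set \<Rightarrow> ('f, 'p, 'u) str \<Rightarrow> ('i, 'f, 'p, 'u) triple set" where
  "gtp L K prec b X A = {t. (E_at L K prec)\<^sup>+\<^sup>+ (b, X, A) t}"

definition galois_types ::
  "('f, 'p) language \<Rightarrow> ('f, 'p, 'u) str set \<Rightarrow>
   (('f, 'p, 'u) str \<Rightarrow> ('f, 'p, 'u) str \<Rightarrow> bool) \<Rightarrow>
   ('f, 'p, 'u) str \<Rightarrow> (unit, 'f, 'p, 'u) triple set set" where
  "galois_types L K prec A =
     {gtp L K prec (\<lambda>_ :: unit. b) (carr A) B | b B. B \<in> K \<and> prec A B \<and> b \<in> carr B}"

definition stable_in ::
  "('f, 'p) language \<Rightarrow> ('f, 'p, 'u) str set \<Rightarrow>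
   (('f, 'p, 'u) str \<Rightarrow> ('f, 'p, 'u) str \<Rightarrow> bool) \<Rightarrow> 'u rel \<Rightarrow> bool" where
  "stable_in L K prec \<mu> \<longleftrightarrow>
     small_cardinal \<mu> \<and> LS L K prec \<le>o \<mu> \<and>
     (\<forall>A\<in>K. |carr A| =o \<mu> \<longrightarrow> |galois_types L K prec A| \<le>o \<mu>)"

definition aec_stable ::
  "('f, 'p) language \<Rightarrow> ('f, 'p, 'u) str set \<Rightarrow>
   (('f, 'p, 'u) str \<Rightarrow> ('f, 'p, 'u) str \<Rightarrow> bool) \<Rightarrow> bool" where
  "aec_stable L K prec \<longleftrightarrow>
     (\<forall>\<kappa> :: 'u rel. small_cardinal \<kappa> \<longrightarrow> (\<exists>\<mu>. \<kappa> \<le>o \<mu> \<and> stable_in L K prec \<mu>))"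


section \<open>Modules\<close>

text \<open>
  The ring is a type of sort \<open>{ring, monoid_mult}\<close>: associative and unital, not necessarily
  commutative, and (unlike in class \<open>ring_1\<close>) possibly the zero ring.
\<close>

datatype 'r mod_sym = Zero | Plus | Minus | Scal 'r

fun mod_arity :: "'r mod_sym \<Rightarrow> nat" where
  "mod_arity Zero = 0"
| "mod_arity Plus = 2"
| "mod_arity Minus = 1"
| "mod_arity (Scal r) = 1"

text \<open>There are no relation symbols; \<open>unit\<close> is a dummy for their type.\<close>

definition mod_lang :: "('r mod_sym, unit) language" where
  "mod_lang = \<lparr>fsyms = UNIV, psyms = {}, farity = mod_arity, parity = (\<lambda>_. 0)\<rparr>"

type_synonym ('r, 'u) modstr = "('r mod_sym, unit, 'u) str"

abbreviation mzero :: "('r, 'u) modstr \<Rightarrow> 'u" where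
  "mzero A \<equiv> fn A Zero []"
abbreviation mplus :: "('r, 'u) modstr \<Rightarrow> 'u \<Rightarrow> 'u \<Rightarrow> 'u" where
  "mplus A x y \<equiv> fn A Plus [x, y]"
abbreviation mminus :: "('r, 'u) modstr \<Rightarrow> 'u \<Rightarrow> 'u" where
  "mminus A x \<equiv> fn A Minus [x]"
abbreviation mscal :: "('r, 'u) modstr \<Rightarrow> 'r \<Rightarrow> 'u \<Rightarrow> 'u" where
  "mscal A r x \<equiv> fn A (Scal r) [x]"

definition add_monoid_of :: "('r, 'u) modstr \<Rightarrow> 'u monoid" where
  "add_monoid_of A = \<lparr>carrier = carr A, mult = mplus A, one = mzero A\<rparr>"

definition RMod :: "('r :: {ring, monoid_mult}, 'u) modstr set" where
  "RMod = {A. is_str mod_lang A \<and> comm_group (add_monoid_of A) \<and>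
     (\<forall>x\<in>carr A. mplus A x (mminus A x) = mzero A) \<and>
     (\<forall>x\<in>carr A. mscal A 1 x = x) \<and>
     (\<forall>r s. \<forall>x\<in>carr A. mscal A (r * s) x = mscal A r (mscal A s x)) \<and>
     (\<forall>r s. \<forall>x\<in>carr A. mscal A (r + s) x = mplus A (mscal A r x) (mscal A s x)) \<and>
     (\<forall>r. \<forall>x\<in>carr A. \<forall>y\<in>carr A.
        mscal A r (mplus A x y) = mplus A (mscal A r x) (mscal A r y))}"

definition submodule ::
  "('r :: {ring, monoid_mult}, 'u) modstr \<Rightarrow> ('r, 'u) modstr \<Rightarrow> bool" where
  "submodule A B \<longleftrightarrow> A \<in> RMod \<and> B \<in> RMod \<and> substructure mod_lang A B"


section \<open>E-nice relations\<close>

text \<open>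
  The formula with free variables \<open>x\<^sub>0, \<dots>, x\<^sub>n\<^sub>-\<^sub>1\<close> for \<open>n = nfree\<close>, bound variables \<open>v\<^sub>\<ell>\<close> and
  equations indexed by \<open>i\<close>, where both \<open>\<ell>\<close> and \<open>i\<close> range over \<open>Field lam\<close> for a cardinal
  \<open>lam\<close> (values of the coefficient functions at other arguments are irrelevant).
\<close>

record ('r, 'u) eformula =
  nfree :: nat
  vcoef :: "'u \<Rightarrow> 'u \<Rightarrow> 'r"
  xcoef :: "'u \<Rightarrow> nat \<Rightarrow> 'r"

definition is_eformula :: "'u rel \<Rightarrow> ('r :: {ring, monoid_mult}, 'u) eformula \<Rightarrow> bool" where
  "is_eformula lam \<phi> \<longleftrightarrow> (\<forall>i\<in>Field lam. finite {l \<in> Field lam. vcoef \<phi> i l \<noteq> 0})"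

definition sat ::
  "'u rel \<Rightarrow> ('r :: {ring, monoid_mult}, 'u) modstr \<Rightarrow> ('r, 'u) eformula \<Rightarrow> 'u list \<Rightarrow> bool" where
  "sat lam A \<phi> a \<longleftrightarrow>
     (\<exists>v. (\<forall>l\<in>Field lam. v l \<in> carr A) \<and>
       (\<forall>i\<in>Field lam.
          mplus A
            (finprod (add_monoid_of A) (\<lambda>l. mscal A (vcoef \<phi> i l) (v l))
               {l \<in> Field lam. vcoef \<phi> i l \<noteq> 0})
            (finprod (add_monoid_of A) (\<lambda>j. mscal A (xcoef \<phi> i j) (a ! j)) {..<nfree \<phi>})
          = mzero A))"

definition le_Sigma ::
  "'u rel \<Rightarrow> ('r :: {ring, monoid_mult}, 'u) eformula set \<Rightarrow>
   ('r, 'u) modstr \<Rightarrow> ('r, 'u) modstr \<Rightarrow> bool" where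
  "le_Sigma lam \<Sigma> A B \<longleftrightarrow> submodule A B \<and>
     (\<forall>\<phi>\<in>\<Sigma>. \<forall>a. length a = nfree \<phi> \<and> set a \<subseteq> carr A \<longrightarrow> (sat lam A \<phi> a \<longleftrightarrow> sat lam B \<phi> a))"

text \<open>
  Only the values of \<open>prec\<close> on modules matter.  Since \<open>lam\<close> is a cardinal of the universe, the
  ring is a set of the universe as well.
\<close>

definition E_nice ::
  "(('r :: {ring, monoid_mult}, 'u) modstr \<Rightarrow> ('r, 'u) modstr \<Rightarrow> bool) \<Rightarrow> bool" where
  "E_nice prec \<longleftrightarrow>
     (\<exists>lam :: 'u rel. \<exists>\<Sigma>. small_cardinal lam \<and> cinfinite lam \<and> |UNIV :: 'r set| \<le>o lam \<and>
        (\<forall>\<phi>\<in>\<Sigma>. is_eformula lam \<phi>) \<and>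
        (\<forall>A\<in>RMod. \<forall>B\<in>RMod. prec A B \<longleftrightarrow> le_Sigma lam \<Sigma> A B))"

definition restrict_rel :: "'a set \<Rightarrow> ('a \<Rightarrow> 'a \<Rightarrow> bool) \<Rightarrow> 'a \<Rightarrow> 'a \<Rightarrow> bool" where
  "restrict_rel K prec A B \<longleftrightarrow> A \<in> K \<and> B \<in> K \<and> prec A B"

end

theory Submission
  imports Defs
begin

text \<open>
  Pushouts of modules in \<open>K\<close> need not lie in \<open>K\<close>, so equality of Galois types cannot be
  obtained by amalgamating extensions.  Closure under submodules makes amalgamation
  unnecessary: every Galois type over \<open>A\<close> is already realised in an extension of \<open>A\<close> by few
  generators, and such extensions can be counted up to isomorphism over \<open>A\<close>.

  Let \<open>A\<close> be strong in \<open>B\<close>, let \<open>b \<in> B\<close>, and let \<open>\<lambda>\<close> and \<open>\<Sigma>\<close> witness E-niceness.  There is a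
  submodule \<open>C\<close> of \<open>B\<close> of size at most \<open>2\<^sup>\<lambda>\<close> with \<open>b \<in> C\<close> such that \<open>A + C\<close> is strong in \<open>B\<close>
  (\<open>small_pure_extension\<close>).  Since \<open>A\<close> may be large, one cannot add witnesses for all the
  formulas \<open>\<phi>(a + c)\<close> that hold in \<open>B\<close>.  But the solutions of homogeneous linear systems add up:
  for fixed \<open>\<phi> \<in> \<Sigma>\<close> and \<open>c\<close> from \<open>C\<close> it is enough that \<open>C\<close> contains a witness for a single
  \<open>\<phi>(a\<^sub>0 + c)\<close>.  If \<open>B\<close> also satisfies \<open>\<phi>(a + c)\<close>, then it satisfies \<open>\<phi>(a - a\<^sub>0)\<close>, hence so does
  \<open>A\<close>, and the sum of the two witnesses is a witness for \<open>\<phi>(a + c)\<close> in \<open>A + C\<close>.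

  By closure under submodules \<open>A + C\<close> is in \<open>K\<close>, so the types of \<open>b\<close> over \<open>A\<close> in \<open>B\<close> and in
  \<open>A + C\<close> agree.  Moreover \<open>A + C\<close> is determined up to isomorphism over \<open>A\<close> by the quantifier-free
  type over \<open>A\<close> of an enumeration of \<open>C\<close> (\<open>sum_isomorphic_if_same_qf_type\<close>).  This
  quantifier-free type is coded by a partial function into \<open>A\<close> on a set of size at most \<open>2\<^sup>\<lambda>\<close>,
  so if \<open>|A| = \<mu> = 2\<^sup>\<chi>\<close> with \<open>\<chi> \<ge> 2\<^sup>\<lambda>\<close>, there are at most \<open>\<mu>\<close> types over \<open>A\<close>
  (\<open>few_Galois_types\<close>).  In a universe closed under powersets there are unboundedly many such \<open>\<mu>\<close>.
\<close>

section \<open>Cardinal arithmetic\<close>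

lemma card_of_Times_ordLeq:
  assumes "infinite Z" "|A| \<le>o |Z|" "|B| \<le>o |Z|"
  shows "|A \<times> B| \<le>o |Z|"
  using assms by (simp add: card_of_Sigma_ordLeq_infinite)

lemma card_of_Un_ordLeq:
  assumes "infinite Z" "|A| \<le>o |Z|" "|B| \<le>o |Z|"
  shows "|A \<union> B| \<le>o |Z|"
  using assms card_of_Un_ordLeq_infinite_Field[OF _ _ _ card_of_Card_order, of Z A B]
  by (simp add: Field_card_of)

lemma card_of_Pow_mono:
  assumes "|A| \<le>o |B|"
  shows "|Pow A| \<le>o |Pow B|"
proof -
  obtain f where "inj_on f A" "f ` A \<subseteq> B" using assms card_of_ordLeq[of A B] by auto
  then have "inj_on ((`) f) (Pow A)" "(`) f ` Pow A \<subseteq> Pow B"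
    by (auto intro: inj_on_image_Pow)
  then show ?thesis using card_of_ordLeq[of "Pow A" "Pow B"] by blast
qed

lemma card_of_finite_ordLeq:
  assumes "infinite Z" "finite A"
  shows "|A| \<le>o |Z|"
  using assms ordLess_imp_ordLeq[OF finite_ordLess_infinite[OF card_of_Well_order card_of_Well_order]]
  by (metis Field_card_of)

lemma card_of_lists_ordLeq:
  assumes inf: "infinite Z" and S: "|S| \<le>o |Z|"
  shows "|lists S| \<le>o |Z|"
proof -
  have len: "|{xs. set xs \<subseteq> S \<and> length xs = n}| \<le>o |Z|" for n
  proof (induction n)
    case 0
    have "finite {xs. set xs \<subseteq> S \<and> length xs = 0}" by simp
    then show ?case
      by (rule card_of_finite_ordLeq[OF inf])
  next
    case (Suc n)
    let ?L = "{xs. set xs \<subseteq> S \<and> length xs = n}"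
    have "{xs. set xs \<subseteq> S \<and> length xs = Suc n} \<subseteq> (\<lambda>(x, xs). x # xs) ` (S \<times> ?L)"
      by (force simp: length_Suc_conv)
    moreover have "|S \<times> ?L| \<le>o |Z|"
      by (rule card_of_Times_ordLeq[OF inf S Suc])
    ultimately show ?case
      by (meson card_of_image card_of_mono1 ordLeq_transitive)
  qed
  have "lists S = (\<Union>n::nat. {xs. set xs \<subseteq> S \<and> length xs = n})"
    by (auto simp: lists_eq_set)
  moreover have "|UNIV :: nat set| \<le>o |Z|"
    using inf infinite_iff_card_of_nat by blast
  ultimately show ?thesis
    using card_of_UNION_ordLeq_infinite[OF inf, of UNIV "\<lambda>n. {xs. set xs \<subseteq> S \<and> length xs = n}"] len
    by metis
qed

text \<open>
  The operations have finitely many arguments, so the closure is reached after \<open>\<omega>\<close> steps, and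
  each step adds at most \<open>|Z|\<close> elements.
\<close>

lemma closure_under_finitary_operations:
  fixes opr :: "'j \<Rightarrow> 'a list \<Rightarrow> 'a"
  assumes inf: "infinite Z" and J: "|J| \<le>o |Z|" and XY: "X \<subseteq> Y" and X: "|X| \<le>o |Z|"
    and Y: "\<And>j xs. j \<in> J \<Longrightarrow> set xs \<subseteq> Y \<Longrightarrow> opr j xs \<in> Y"
  obtains C where "X \<subseteq> C" "C \<subseteq> Y" "|C| \<le>o |Z|"
    "\<And>j xs. j \<in> J \<Longrightarrow> set xs \<subseteq> C \<Longrightarrow> opr j xs \<in> C"
proof -
  define D where "D n = ((\<lambda>S. S \<union> (\<lambda>(j, xs). opr j xs) ` (J \<times> lists S)) ^^ n) X" for n
  have D0: "D 0 = X" and DSuc: "D (Suc n) = D n \<union> (\<lambda>(j, xs). opr j xs) ` (J \<times> lists (D n))" for n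
    by (simp_all add: D_def)
  have mono: "D m \<subseteq> D n" if "m \<le> n" for m n
    by (rule lift_Suc_mono_le[OF _ that]) (simp add: DSuc)
  have card: "|D n| \<le>o |Z|" for n
  proof (induction n)
    case 0
    then show ?case using X by (simp add: D0)
  next
    case (Suc n)
    have "|J \<times> lists (D n)| \<le>o |Z|"
      by (rule card_of_Times_ordLeq[OF inf J card_of_lists_ordLeq[OF inf Suc]])
    then have "|(\<lambda>(j, xs). opr j xs) ` (J \<times> lists (D n))| \<le>o |Z|"
      using card_of_image ordLeq_transitive by blast
    then show ?case unfolding DSuc
      by (rule card_of_Un_ordLeq[OF inf Suc])
  qed
  have sub: "D n \<subseteq> Y" for n
  proof (induction n)
    case (Suc n)
    then show ?case using Y by (auto simp: DSuc lists_eq_set)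
  qed (use XY in \<open>simp add: D0\<close>)
  show thesis
  proof (rule that[of "\<Union>n. D n"])
    show "X \<subseteq> (\<Union>n. D n)" using D0 by blast
    show "(\<Union>n. D n) \<subseteq> Y" using sub by blast
    show "|\<Union>n. D n| \<le>o |Z|"
      using card_of_UNION_ordLeq_infinite[OF inf, of "UNIV :: nat set"] card inf
        infinite_iff_card_of_nat by blast
    fix j xs assume j: "j \<in> J" and xs: "set xs \<subseteq> (\<Union>n. D n)"
    have "\<exists>n. set xs \<subseteq> D n"
      using xs
    proof (induction xs)
      case (Cons x xs)
      then obtain m n where "set xs \<subseteq> D m" "x \<in> D n" by auto
      then have "set (x # xs) \<subseteq> D (max m n)"
        using mono[of m "max m n"] mono[of n "max m n"] by auto
      then show ?case by blast
    qed simp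
    then obtain n where "set xs \<subseteq> D n" ..
    then have "opr j xs \<in> D (Suc n)" using j by (force simp: DSuc lists_eq_set)
    then show "opr j xs \<in> (\<Union>n. D n)" by blast
  qed
qed

text \<open>
  In cardinal arithmetic, \<open>(2\<^sup>X)\<^sup>I = 2\<^sup>X\<close> for \<open>|I| \<le> |X|\<close>.  A partial function into the powerset of
  \<open>X\<close> is coded by a set of pairs.
\<close>

lemma card_of_partial_functions:
  assumes inf: "infinite X" and I: "|I| \<le>o |X|" and A: "|A| \<le>o |Pow X|"
  shows "|{r. r \<subseteq> I \<times> A \<and> single_valued r}| \<le>o |Pow X|"
proof -
  obtain g where g: "inj_on g A" "g ` A \<subseteq> Pow X"
    using A card_of_ordLeq[of A "Pow X"] by auto
  \<comment> \<open>The value \<open>None\<close> marks the domain, so that an empty value differs from an undefined one.\<close>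
  define h where "h r = {(i, None) | i. i \<in> Domain r} \<union> {(i, Some x) | i a x. (i, a) \<in> r \<and> x \<in> g a}"
    for r :: "('b \<times> 'c) set"
  let ?R = "{r. r \<subseteq> I \<times> A \<and> single_valued r}"
  let ?P = "I \<times> insert None (Some ` X)"
  have dec: "r = {(i, a). a \<in> A \<and> (i, None) \<in> h r \<and> g a = {x. (i, Some x) \<in> h r}}"
    if r: "r \<in> ?R" for r
  proof -
    have val: "{x. (i, Some x) \<in> h r} = g a" if "(i, a) \<in> r" for i a
      using r that by (auto simp: h_def single_valued_def)
    have dom: "(i, None) \<in> h r \<longleftrightarrow> (\<exists>a\<in>A. (i, a) \<in> r)" for i
      using r by (auto simp: h_def)
    show ?thesis
    proof (rule Set.set_eqI)
      fix p :: "'b \<times> 'c"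
      obtain i a where p: "p = (i, a)" by fastforce
      show "p \<in> r \<longleftrightarrow> p \<in> {(i, a). a \<in> A \<and> (i, None) \<in> h r \<and> g a = {x. (i, Some x) \<in> h r}}"
        using val[of i] dom[of i] r g(1) unfolding p by (auto simp: inj_on_def)
    qed
  qed
  have "inj_on h ?R"
    by (rule inj_on_inverseI[where g = "\<lambda>s. {(i, a). a \<in> A \<and> (i, None) \<in> s \<and> g a = {x. (i, Some x) \<in> s}}"])
      (rule dec[symmetric])
  moreover have "h ` ?R \<subseteq> Pow ?P"
    using g(2) by (auto simp: h_def) 
  ultimately have "|?R| \<le>o |Pow ?P|"
    using card_of_ordLeq[of ?R "Pow ?P"] by blast
  moreover have "|insert None (Some ` X)| \<le>o |X|"
  proof -
    have "insert None (Some ` X) = {None} \<union> Some ` X" by simp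
    moreover have "|{None} \<union> Some ` X| \<le>o |X|"
      by (intro card_of_Un_ordLeq card_of_finite_ordLeq card_of_image inf) simp
    ultimately show ?thesis by simp
  qed
  then have "|?P| \<le>o |X|"
    by (rule card_of_Times_ordLeq[OF inf I])
  then have "|Pow ?P| \<le>o |Pow X|" by (rule card_of_Pow_mono)
  ultimately show ?thesis using ordLeq_transitive by blast
qed

lemma card_of_mod_sym:
  assumes inf: "infinite Z" and R: "|UNIV :: 'r set| \<le>o |Z|"
  shows "|UNIV :: 'r mod_sym set| \<le>o |Z|"
proof -
  have "(UNIV :: 'r mod_sym set) = {Zero, Plus, Minus} \<union> range Scal"
    by (auto intro: mod_sym.exhaust)
  moreover have "|range (Scal :: 'r \<Rightarrow> _)| \<le>o |Z|"
    using card_of_image ordLeq_transitive R by blast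
  moreover have "|{Zero, Plus, Minus} :: 'r mod_sym set| \<le>o |Z|"
    by (rule card_of_finite_ordLeq[OF inf]) simp
  ultimately show ?thesis
    using card_of_Un_ordLeq[OF inf] by metis
qed

section \<open>Modules and submodules\<close>

locale rmodule =
  fixes M :: "('r :: {ring, monoid_mult}, 'u) modstr"
  assumes in_RMod: "M \<in> RMod"
begin

lemma add_monoid_of_sel [simp]:
  "carrier (add_monoid_of M) = carr M"
  "x \<otimes>\<^bsub>add_monoid_of M\<^esub> y = mplus M x y"
  "\<one>\<^bsub>add_monoid_of M\<^esub> = mzero M"
  by (simp_all add: add_monoid_of_def)

sublocale G: comm_group "add_monoid_of M"
  using in_RMod by (simp add: RMod_def)

lemma fn_closed: "length xs = mod_arity s \<Longrightarrow> set xs \<subseteq> carr M \<Longrightarrow> fn M s xs \<in> carr M"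
  using in_RMod unfolding RMod_def is_str_def mod_lang_def by fastforce

lemma fn_default: "length xs \<noteq> mod_arity s \<Longrightarrow> fn M s xs = undefined"
  using in_RMod unfolding RMod_def is_str_def mod_lang_def by fastforce

lemma rl_default: "\<not> rl M p xs"
  using in_RMod unfolding RMod_def is_str_def mod_lang_def by auto

lemma zero_closed [simp]: "mzero M \<in> carr M"
  and plus_closed [simp]: "x \<in> carr M \<Longrightarrow> y \<in> carr M \<Longrightarrow> mplus M x y \<in> carr M"
  and minus_closed [simp]: "x \<in> carr M \<Longrightarrow> mminus M x \<in> carr M"
  and scal_closed [simp]: "x \<in> carr M \<Longrightarrow> mscal M r x \<in> carr M"
  by (simp_all add: fn_closed)

lemma zero_left [simp]: "x \<in> carr M \<Longrightarrow> mplus M (mzero M) x = x"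
  and zero_right [simp]: "x \<in> carr M \<Longrightarrow> mplus M x (mzero M) = x"
  using G.l_one G.r_one by simp_all

lemma plus_assoc:
  "x \<in> carr M \<Longrightarrow> y \<in> carr M \<Longrightarrow> z \<in> carr M \<Longrightarrow>
   mplus M (mplus M x y) z = mplus M x (mplus M y z)"
  using G.m_assoc by simp

lemma plus_commute: "x \<in> carr M \<Longrightarrow> y \<in> carr M \<Longrightarrow> mplus M x y = mplus M y x"
  using G.m_comm by simp

lemma plus_left_commute:
  "x \<in> carr M \<Longrightarrow> y \<in> carr M \<Longrightarrow> z \<in> carr M \<Longrightarrow>
   mplus M x (mplus M y z) = mplus M y (mplus M x z)"
  using G.m_lcomm by simp

lemmas plus_ac = plus_assoc plus_commute plus_left_commute

lemma plus_left_cancel: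
  "x \<in> carr M \<Longrightarrow> y \<in> carr M \<Longrightarrow> z \<in> carr M \<Longrightarrow> mplus M x y = mplus M x z \<longleftrightarrow> y = z"
  using G.right_cancel [of x y z] plus_commute by simp

lemma plus_right_cancel:
  "x \<in> carr M \<Longrightarrow> y \<in> carr M \<Longrightarrow> z \<in> carr M \<Longrightarrow> mplus M y x = mplus M z x \<longleftrightarrow> y = z"
  using G.right_cancel [of x y z] by simp

lemma minus_right [simp]: "x \<in> carr M \<Longrightarrow> mplus M x (mminus M x) = mzero M"
  using in_RMod by (simp add: RMod_def)

lemma minus_left [simp]: "x \<in> carr M \<Longrightarrow> mplus M (mminus M x) x = mzero M"
  by (simp add: plus_commute[of "mminus M x"])

lemma scal_one [simp]: "x \<in> carr M \<Longrightarrow> mscal M 1 x = x"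
  and scal_mult: "x \<in> carr M \<Longrightarrow> mscal M (r * s) x = mscal M r (mscal M s x)"
  and scal_plus_left: "x \<in> carr M \<Longrightarrow> mscal M (r + s) x = mplus M (mscal M r x) (mscal M s x)"
  and scal_plus: "x \<in> carr M \<Longrightarrow> y \<in> carr M \<Longrightarrow>
    mscal M r (mplus M x y) = mplus M (mscal M r x) (mscal M r y)"
  using in_RMod unfolding RMod_def by blast+

lemma plus_eq_self_iff: "x \<in> carr M \<Longrightarrow> y \<in> carr M \<Longrightarrow> mplus M x y = x \<longleftrightarrow> y = mzero M"
  using plus_left_cancel[of x y "mzero M"] by simp

lemma eq_minus_iff: "x \<in> carr M \<Longrightarrow> y \<in> carr M \<Longrightarrow> y = mminus M x \<longleftrightarrow> mplus M x y = mzero M"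
  using plus_left_cancel[of x y "mminus M x"] by auto

end

definition closed_in :: "('r, 'u) modstr \<Rightarrow> 'u set \<Rightarrow> bool" where
  "closed_in M S \<longleftrightarrow> S \<subseteq> carr M \<and>
     (\<forall>s xs. length xs = mod_arity s \<and> set xs \<subseteq> S \<longrightarrow> fn M s xs \<in> S)"

lemma carr_induced [simp]: "carr (induced M S) = S"
  by (simp add: induced_def)

lemma fn_induced [simp]: "set xs \<subseteq> S \<Longrightarrow> fn (induced M S) s xs = fn M s xs"
  by (simp add: induced_def)

lemma closed_inD:
  assumes "closed_in M S"
  shows "S \<subseteq> carr M" "mzero M \<in> S" "x \<in> S \<Longrightarrow> y \<in> S \<Longrightarrow> mplus M x y \<in> S"
    "x \<in> S \<Longrightarrow> mminus M x \<in> S" "x \<in> S \<Longrightarrow> mscal M r x \<in> S"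
  using assms unfolding closed_in_def by simp_all

context rmodule
begin

lemma closed_inI:
  assumes "S \<subseteq> carr M" "mzero M \<in> S" "\<And>x y. x \<in> S \<Longrightarrow> y \<in> S \<Longrightarrow> mplus M x y \<in> S"
    "\<And>x. x \<in> S \<Longrightarrow> mminus M x \<in> S" "\<And>x r. x \<in> S \<Longrightarrow> mscal M r x \<in> S"
  shows "closed_in M S"
  unfolding closed_in_def
proof (intro conjI allI impI)
  fix s :: "'r mod_sym" and xs assume xs: "length xs = mod_arity s \<and> set xs \<subseteq> S"
  show "fn M s xs \<in> S"
  proof (cases s)
    case Plus
    then obtain x y where "xs = [x, y]" using xs by (auto simp: length_Suc_conv numeral_2_eq_2)
    then show ?thesis using xs assms(3) Plus by simp
  qed (use xs assms in \<open>auto simp: length_Suc_conv\<close>)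
qed (fact assms(1))

lemma submodule_induced:
  assumes S: "closed_in M S"
  shows "submodule (induced M S) M"
proof -
  note cl = closed_inD[OF S]
  have M: "is_str mod_lang M" using in_RMod by (simp add: RMod_def)
  have small: "small S"
    using M card_of_mono1[OF cl(1)] unfolding is_str_def small_def
    using ordLeq_ordLess_trans by blast
  have ne: "S \<noteq> {}" using cl(2) by blast
  have str: "is_str mod_lang (induced M S)"
    using ne small S rl_default fn_default
    unfolding is_str_def closed_in_def by (auto simp: induced_def mod_lang_def)
  have "induced M S \<in> RMod"
    unfolding RMod_def
  proof (intro CollectI conjI)
    show "comm_group (add_monoid_of (induced M S))"
    proof (rule comm_groupI)
      fix x assume "x \<in> carrier (add_monoid_of (induced M S))"
      then have x: "x \<in> S" "x \<in> carr M" using cl(1) by (auto simp: add_monoid_of_def)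
      show "\<exists>y\<in>carrier (add_monoid_of (induced M S)).
        y \<otimes>\<^bsub>add_monoid_of (induced M S)\<^esub> x = \<one>\<^bsub>add_monoid_of (induced M S)\<^esub>"
        using x cl by (intro bexI[of _ "mminus M x"]) (auto simp: add_monoid_of_def)
    qed (use cl in \<open>auto simp: add_monoid_of_def subset_eq plus_ac\<close>)
  qed (use cl in \<open>auto simp: str scal_mult scal_plus_left scal_plus subset_eq\<close>)
  then show ?thesis
    unfolding submodule_def substructure_def using in_RMod str M cl(1) by simp
qed

lemma rmodule_induced: "closed_in M S \<Longrightarrow> rmodule (induced M S)"
  using submodule_induced by (simp add: rmodule_def submodule_def)

end

text \<open>
  Together with \<open>submodule_induced\<close>: submodules of \<open>B\<close> correspond to closed subsets of \<open>B\<close>, so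
  that all computations can be done with the operations of \<open>B\<close>.
\<close>

lemma closed_in_submodule:
  assumes "submodule A B"
  shows "closed_in B (carr A)" "A = induced B (carr A)"
proof -
  show *: "A = induced B (carr A)" using assms by (simp add: submodule_def substructure_def)
  interpret A: rmodule A using assms by unfold_locales (simp add: submodule_def)
  have "fn B s xs \<in> carr A" if "length xs = mod_arity s" "set xs \<subseteq> carr A" for s xs
    using A.fn_closed[OF that] fn_induced[OF that(2), of B s] * by simp
  then show "closed_in B (carr A)"
    using assms by (simp add: closed_in_def submodule_def substructure_def)
qed

section \<open>Systems of linear equations\<close>

text \<open>
  Assignments to the free variables are functions instead of lists, so that they can be added
  pointwise.
\<close>

definition lhs ::
  "('r :: {ring, monoid_mult}, 'u) modstr \<Rightarrow> 'u rel \<Rightarrow> ('r, 'u) eformula \<Rightarrow>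
   ('u \<Rightarrow> 'u) \<Rightarrow> (nat \<Rightarrow> 'u) \<Rightarrow> 'u \<Rightarrow> 'u" where
  "lhs A lam \<phi> v y i =
     mplus A
       (finprod (add_monoid_of A) (\<lambda>l. mscal A (vcoef \<phi> i l) (v l))
          {l \<in> Field lam. vcoef \<phi> i l \<noteq> 0})
       (finprod (add_monoid_of A) (\<lambda>j. mscal A (xcoef \<phi> i j) (y j)) {..<nfree \<phi>})"

lemma sat_lhs:
  "sat lam A \<phi> a \<longleftrightarrow>
     (\<exists>v. (\<forall>l\<in>Field lam. v l \<in> carr A) \<and> (\<forall>i\<in>Field lam. lhs A lam \<phi> v ((!) a) i = mzero A))"
  by (simp add: sat_def lhs_def)

context rmodule
begin

lemma finprod_induced:
  assumes S: "closed_in M S" and f: "f \<in> I \<rightarrow> S"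
  shows "finprod (add_monoid_of (induced M S)) f I = finprod (add_monoid_of M) f I"
proof -
  interpret S: rmodule "induced M S" by (rule rmodule_induced[OF S])
  have "finprod (add_monoid_of (induced M S)) f I = finprod (add_monoid_of M) f I
    \<and> finprod (add_monoid_of M) f I \<in> S"
    using f
  proof (induction I rule: infinite_finite_induct)
    case (insert x I)
    have "f \<in> I \<rightarrow> carr M" "f x \<in> carr M" using insert.prems closed_inD(1)[OF S] by auto
    then show ?case
      using insert closed_inD[OF S] by (auto simp: Pi_iff S.G.finprod_insert G.finprod_insert)
  qed (use closed_inD[OF S] in auto)
  then show ?thesis ..
qed

lemma lhs_closed:
  assumes "\<forall>l\<in>Field lam. v l \<in> carr M" "\<forall>j<nfree \<phi>. y j \<in> carr M"
  shows "lhs M lam \<phi> v y i \<in> carr M"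
  unfolding lhs_def using assms
  by (intro plus_closed G.finprod_closed[unfolded add_monoid_of_sel]) auto

lemma lhs_induced:
  assumes S: "closed_in M S" and "\<forall>l\<in>Field lam. v l \<in> S" "\<forall>j<nfree \<phi>. y j \<in> S"
  shows "lhs (induced M S) lam \<phi> v y i = lhs M lam \<phi> v y i"
proof -
  interpret S: rmodule "induced M S" by (rule rmodule_induced[OF S])
  note cl = closed_inD[OF S]
  let ?F = "{l \<in> Field lam. vcoef \<phi> i l \<noteq> 0}"
  have 1: "finprod (add_monoid_of (induced M S)) (\<lambda>l. mscal (induced M S) (vcoef \<phi> i l) (v l)) ?F
    = finprod (add_monoid_of M) (\<lambda>l. mscal M (vcoef \<phi> i l) (v l)) ?F" (is "?a = ?b")
  proof -
    have "?a = finprod (add_monoid_of (induced M S)) (\<lambda>l. mscal M (vcoef \<phi> i l) (v l)) ?F"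
      by (rule S.G.finprod_cong') (use assms cl in auto)
    also have "\<dots> = ?b" by (rule finprod_induced[OF S]) (use assms cl in auto)
    finally show ?thesis .
  qed
  have 2: "finprod (add_monoid_of (induced M S)) (\<lambda>j. mscal (induced M S) (xcoef \<phi> i j) (y j)) {..<nfree \<phi>}
    = finprod (add_monoid_of M) (\<lambda>j. mscal M (xcoef \<phi> i j) (y j)) {..<nfree \<phi>}" (is "?c = ?d")
  proof -
    have "?c = finprod (add_monoid_of (induced M S)) (\<lambda>j. mscal M (xcoef \<phi> i j) (y j)) {..<nfree \<phi>}"
      by (rule S.G.finprod_cong') (use assms cl in auto)
    also have "\<dots> = ?d" by (rule finprod_induced[OF S]) (use assms cl in auto)
    finally show ?thesis .
  qed
  have "?b = ?a" "?d = ?c" using 1 2 by simp_all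
  moreover have "?a \<in> S" "?c \<in> S"
    using assms cl S.G.finprod_closed[of _ ?F] S.G.finprod_closed[of _ "{..<nfree \<phi>}"]
    by (auto simp: Pi_iff)
  ultimately show ?thesis unfolding lhs_def 1 2 by simp
qed

text \<open>
  Additivity lets one chosen solution serve all instances of a formula that differ by a tuple
  from a submodule.
\<close>

lemma lhs_plus:
  assumes "\<forall>l\<in>Field lam. v l \<in> carr M" "\<forall>j<nfree \<phi>. y j \<in> carr M"
    and "\<forall>l\<in>Field lam. v' l \<in> carr M" "\<forall>j<nfree \<phi>. y' j \<in> carr M"
  shows "lhs M lam \<phi> (\<lambda>l. mplus M (v l) (v' l)) (\<lambda>j. mplus M (y j) (y' j)) i =
    mplus M (lhs M lam \<phi> v y i) (lhs M lam \<phi> v' y' i)"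
proof -
  let ?F = "{l \<in> Field lam. vcoef \<phi> i l \<noteq> 0}"
  let ?s = "\<lambda>v. finprod (add_monoid_of M) (\<lambda>l. mscal M (vcoef \<phi> i l) (v l)) ?F"
  let ?t = "\<lambda>y. finprod (add_monoid_of M) (\<lambda>j. mscal M (xcoef \<phi> i j) (y j)) {..<nfree \<phi>}"
  have mult: "finprod (add_monoid_of M) (\<lambda>k. mplus M (f k) (g k)) I =
    mplus M (finprod (add_monoid_of M) f I) (finprod (add_monoid_of M) g I)"
    if "f \<in> I \<rightarrow> carr M" "g \<in> I \<rightarrow> carr M" for f g :: "'i \<Rightarrow> 'u" and I
    using G.finprod_multf[of f I g] that by simp
  have s: "?s (\<lambda>l. mplus M (v l) (v' l)) = mplus M (?s v) (?s v')"
    by (subst mult[symmetric]) (use assms in \<open>auto intro!: G.finprod_cong' simp: scal_plus\<close>)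
  have t: "?t (\<lambda>j. mplus M (y j) (y' j)) = mplus M (?t y) (?t y')"
    by (subst mult[symmetric]) (use assms in \<open>auto intro!: G.finprod_cong' simp: scal_plus\<close>)
  have "?s v \<in> carr M" "?s v' \<in> carr M" "?t y \<in> carr M" "?t y' \<in> carr M"
    using assms G.finprod_closed[of _ ?F] G.finprod_closed[of _ "{..<nfree \<phi>}"]
    by (auto simp: Pi_iff)
  then show ?thesis unfolding lhs_def s t by (simp add: plus_ac)
qed

lemma lhs_cong:
  assumes "\<forall>l\<in>Field lam. v l = v' l \<and> v' l \<in> carr M" "\<forall>j<nfree \<phi>. y j = y' j \<and> y' j \<in> carr M"
  shows "lhs M lam \<phi> v y i = lhs M lam \<phi> v' y' i"
  unfolding lhs_def using assms
  by (intro arg_cong2[where f = "mplus M"] G.finprod_cong') auto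

lemma sat_induced:
  assumes S: "closed_in M S" and a: "set a \<subseteq> S" "length a = nfree \<phi>"
  shows "sat lam (induced M S) \<phi> a \<longleftrightarrow>
    (\<exists>v. (\<forall>l\<in>Field lam. v l \<in> S) \<and> (\<forall>i\<in>Field lam. lhs M lam \<phi> v ((!) a) i = mzero M))"
proof -
  have "\<forall>j<nfree \<phi>. a ! j \<in> S" using a by auto
  then show ?thesis unfolding sat_lhs using lhs_induced[OF S] by auto
qed

end

definition solves ::
  "('r :: {ring, monoid_mult}, 'u) modstr \<Rightarrow> 'u rel \<Rightarrow> ('r, 'u) eformula \<Rightarrow>
   ('u \<Rightarrow> 'u) \<Rightarrow> (nat \<Rightarrow> 'u) \<Rightarrow> bool" where
  "solves M lam \<phi> v y \<longleftrightarrow> (\<forall>i\<in>Field lam. lhs M lam \<phi> v y i = mzero M)"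

text \<open>
  The relation \<open>\<le>\<^sub>\<Sigma>\<close> read inside the larger module, see \<open>le_Sigma_induced_iff\<close> below.
\<close>

definition pure_for ::
  "('r :: {ring, monoid_mult}, 'u) modstr \<Rightarrow> 'u rel \<Rightarrow> ('r, 'u) eformula \<Rightarrow> 'u set \<Rightarrow> bool" where
  "pure_for M lam \<phi> D \<longleftrightarrow>
     (\<forall>y v. (\<forall>j<nfree \<phi>. y j \<in> D) \<longrightarrow> (\<forall>l\<in>Field lam. v l \<in> carr M) \<longrightarrow> solves M lam \<phi> v y \<longrightarrow>
        (\<exists>w. (\<forall>l\<in>Field lam. w l \<in> D) \<and> solves M lam \<phi> w y))"

definition module_sum :: "('r, 'u) modstr \<Rightarrow> 'u set \<Rightarrow> 'u set \<Rightarrow> 'u set" where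
  "module_sum M S T = {mplus M s t | s t. s \<in> S \<and> t \<in> T}"

text \<open>
  A set \<open>\<Sigma>\<close> of formulas can have more than \<open>2\<^sup>\<lambda>\<close> elements, because coefficient functions are
  unconstrained outside \<open>Field lam\<close>; up to the equivalence below there are at most \<open>2\<^sup>\<lambda>\<close> formulas.
\<close>

definition same_equations ::
  "'u rel \<Rightarrow> ('r :: {ring, monoid_mult}, 'u) eformula \<Rightarrow> ('r, 'u) eformula \<Rightarrow> bool" where
  "same_equations lam \<phi> \<psi> \<longleftrightarrow> nfree \<phi> = nfree \<psi> \<and>
     (\<forall>i\<in>Field lam. \<forall>l\<in>Field lam. vcoef \<phi> i l = vcoef \<psi> i l) \<and>
     (\<forall>i\<in>Field lam. \<forall>j. xcoef \<phi> i j = xcoef \<psi> i j)"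

lemma few_systems_of_equations:
  fixes lam :: "'u rel" and \<Sigma> :: "('r :: {ring, monoid_mult}, 'u) eformula set"
  assumes inf: "infinite (Field lam)" and R: "|UNIV :: 'r set| \<le>o |Field lam|"
  obtains \<Sigma>' where "\<Sigma>' \<subseteq> \<Sigma>" "|\<Sigma>'| \<le>o |Pow (Field lam)|"
    "\<And>\<phi>. \<phi> \<in> \<Sigma> \<Longrightarrow> \<exists>\<psi>\<in>\<Sigma>'. same_equations lam \<psi> \<phi>"
proof -
  let ?F = "Field lam"
  define code where "code \<phi> =
    (nfree \<phi>, {(i, l, vcoef \<phi> i l) | i l. i \<in> ?F \<and> l \<in> ?F}, {(i, j, xcoef \<phi> i j) | i j. i \<in> ?F})"
    for \<phi> :: "('r, 'u) eformula"
  define \<Sigma>' where "\<Sigma>' = inv_into \<Sigma> code ` (code ` \<Sigma>)"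
  have nat: "|UNIV :: nat set| \<le>o |?F|" using inf infinite_iff_card_of_nat by blast
  have infP: "infinite (Pow ?F)" using inf by simp
  have FP: "|?F| \<le>o |Pow ?F|" by (rule ordLess_imp_ordLeq[OF card_of_Pow])
  have sub: "code ` \<Sigma> \<subseteq> UNIV \<times> Pow (?F \<times> ?F \<times> UNIV) \<times> Pow (?F \<times> UNIV \<times> UNIV)"
    by (auto simp: code_def)
  have "|(UNIV :: nat set) \<times> Pow (?F \<times> ?F \<times> (UNIV :: 'r set)) \<times>
      Pow (?F \<times> (UNIV :: nat set) \<times> (UNIV :: 'r set))| \<le>o |Pow ?F|"
    by (intro card_of_Times_ordLeq infP card_of_Pow_mono ordLeq_transitive[OF nat FP]
        card_of_Times_ordLeq[OF inf] nat R ordLeq_refl card_of_Card_order)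
  then have "|code ` \<Sigma>| \<le>o |Pow ?F|"
    by (rule ordLeq_transitive[OF card_of_mono1[OF sub]])
  then have "|\<Sigma>'| \<le>o |Pow ?F|"
    unfolding \<Sigma>'_def by (rule ordLeq_transitive[OF card_of_image])
  moreover have "\<Sigma>' \<subseteq> \<Sigma>" unfolding \<Sigma>'_def by (auto intro: inv_into_into)
  moreover have "\<exists>\<psi>\<in>\<Sigma>'. same_equations lam \<psi> \<phi>" if "\<phi> \<in> \<Sigma>" for \<phi>
  proof
    show "inv_into \<Sigma> code (code \<phi>) \<in> \<Sigma>'" using that by (auto simp: \<Sigma>'_def)
    have "code (inv_into \<Sigma> code (code \<phi>)) = code \<phi>" using that by (auto intro: f_inv_into_f)
    then show "same_equations lam (inv_into \<Sigma> code (code \<phi>)) \<phi>"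
      unfolding code_def same_equations_def by blast
  qed
  ultimately show thesis using that by blast
qed

context rmodule
begin

lemma same_equations_lhs:
  assumes "same_equations lam \<phi> \<psi>" "i \<in> Field lam"
    and "\<forall>l\<in>Field lam. v l \<in> carr M" "\<forall>j<nfree \<phi>. y j \<in> carr M"
  shows "lhs M lam \<phi> v y i = lhs M lam \<psi> v y i"
proof -
  have *: "{l \<in> Field lam. vcoef \<phi> i l \<noteq> 0} = {l \<in> Field lam. vcoef \<psi> i l \<noteq> 0}"
    "nfree \<phi> = nfree \<psi>"
    using assms(1,2) by (auto simp: same_equations_def)
  show ?thesis
    unfolding lhs_def * using assms
    by (intro arg_cong2[where f = "mplus M"] G.finprod_cong') (auto simp: same_equations_def)
qed

lemma same_equations_pure:
  assumes "same_equations lam \<phi> \<psi>" "D \<subseteq> carr M" "pure_for M lam \<phi> D"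
  shows "pure_for M lam \<psi> D"
  unfolding pure_for_def
proof (intro allI impI)
  fix y v
  assume y: "\<forall>j<nfree \<psi>. y j \<in> D" and v: "\<forall>l\<in>Field lam. v l \<in> carr M" and s: "solves M lam \<psi> v y"
  have n: "nfree \<phi> = nfree \<psi>" using assms(1) by (simp add: same_equations_def)
  have iff: "solves M lam \<phi> w y \<longleftrightarrow> solves M lam \<psi> w y" if "\<forall>l\<in>Field lam. w l \<in> carr M" for w
    unfolding solves_def using same_equations_lhs[OF assms(1) _ that, of _ y] y assms(2) n
    by (simp add: subset_eq)
  then obtain w where "\<forall>l\<in>Field lam. w l \<in> D" "solves M lam \<phi> w y"
    using assms(3) y v s n unfolding pure_for_def by metis
  then show "\<exists>w. (\<forall>l\<in>Field lam. w l \<in> D) \<and> solves M lam \<psi> w y"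
    using iff assms(2) by blast
qed

lemma solves_cong:
  assumes "\<forall>l\<in>Field lam. v l = v' l \<and> v' l \<in> carr M" "\<forall>j<nfree \<phi>. y j = y' j \<and> y' j \<in> carr M"
  shows "solves M lam \<phi> v y \<longleftrightarrow> solves M lam \<phi> v' y'"
  unfolding solves_def using lhs_cong[OF assms] by simp

lemma le_Sigma_induced_iff:
  assumes D: "closed_in M D"
  shows "le_Sigma lam \<Sigma> (induced M D) M \<longleftrightarrow> (\<forall>\<phi>\<in>\<Sigma>. pure_for M lam \<phi> D)"
proof -
  note DM = closed_inD(1)[OF D]
  have "(\<forall>a. length a = nfree \<phi> \<and> set a \<subseteq> D \<longrightarrow> (sat lam (induced M D) \<phi> a \<longleftrightarrow> sat lam M \<phi> a))
    \<longleftrightarrow> pure_for M lam \<phi> D" for \<phi>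
  proof
    assume L: "\<forall>a. length a = nfree \<phi> \<and> set a \<subseteq> D \<longrightarrow> (sat lam (induced M D) \<phi> a \<longleftrightarrow> sat lam M \<phi> a)"
    show "pure_for M lam \<phi> D"
      unfolding pure_for_def
    proof (intro allI impI)
      fix y v
      assume y: "\<forall>j<nfree \<phi>. y j \<in> D" and v: "\<forall>l\<in>Field lam. v l \<in> carr M"
        and s: "solves M lam \<phi> v y"
      define a where "a = map y [0..<nfree \<phi>]"
      have a: "length a = nfree \<phi>" "set a \<subseteq> D" using y by (auto simp: a_def)
      have eq: "solves M lam \<phi> w ((!) a) \<longleftrightarrow> solves M lam \<phi> w y"
        if "\<forall>l\<in>Field lam. w l \<in> carr M" for w
        by (rule solves_cong) (use that y DM in \<open>auto simp: a_def\<close>)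
      have "sat lam M \<phi> a" using v s eq[OF v] unfolding sat_lhs solves_def by blast
      then have "sat lam (induced M D) \<phi> a" using L a by blast
      then obtain w where w: "\<forall>l\<in>Field lam. w l \<in> D" "solves M lam \<phi> w ((!) a)"
        unfolding sat_induced[OF D a(2,1)] solves_def by blast
      then show "\<exists>w. (\<forall>l\<in>Field lam. w l \<in> D) \<and> solves M lam \<phi> w y"
        using eq[of w] DM by blast
    qed
  next
    assume P: "pure_for M lam \<phi> D"
    show "\<forall>a. length a = nfree \<phi> \<and> set a \<subseteq> D \<longrightarrow> (sat lam (induced M D) \<phi> a \<longleftrightarrow> sat lam M \<phi> a)"
    proof (intro allI impI)
      fix a assume a: "length a = nfree \<phi> \<and> set a \<subseteq> D"
      then have "\<forall>j<nfree \<phi>. a ! j \<in> D" by auto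
      then show "sat lam (induced M D) \<phi> a \<longleftrightarrow> sat lam M \<phi> a"
        using P DM a unfolding pure_for_def solves_def sat_lhs[of lam M]
        by (subst sat_induced[OF D]) (auto, blast)
    qed
  qed
  then show ?thesis
    unfolding le_Sigma_def using submodule_induced[OF D] by auto
qed

end

section \<open>Small pure extensions\<close>

context rmodule
begin

lemma module_sumI: "s \<in> S \<Longrightarrow> t \<in> T \<Longrightarrow> mplus M s t \<in> module_sum M S T"
  by (auto simp: module_sum_def)

lemma closed_in_module_sum:
  assumes S: "closed_in M S" and T: "closed_in M T"
  shows "closed_in M (module_sum M S T)" "S \<subseteq> module_sum M S T" "T \<subseteq> module_sum M S T"
proof -
  note cS = closed_inD[OF S] and cT = closed_inD[OF T]
  show 1: "S \<subseteq> module_sum M S T"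
    using module_sumI[OF _ cT(2)] cS(1) by (metis subset_eq zero_right)
  show "T \<subseteq> module_sum M S T"
    using module_sumI[OF cS(2)] cT(1) by (metis subset_eq zero_left)
  show "closed_in M (module_sum M S T)"
  proof (rule closed_inI)
    show "module_sum M S T \<subseteq> carr M" using cS(1) cT(1) by (auto simp: module_sum_def subset_eq)
    show "mzero M \<in> module_sum M S T" using 1 cS(2) by blast
  next
    fix x y assume "x \<in> module_sum M S T" "y \<in> module_sum M S T"
    then obtain s t s' t' where x: "s \<in> S" "t \<in> T" "x = mplus M s t"
      and y: "s' \<in> S" "t' \<in> T" "y = mplus M s' t'" by (auto simp: module_sum_def)
    have "mplus M x y = mplus M (mplus M s s') (mplus M t t')"
      using x y cS(1) cT(1) by (auto simp: plus_ac subset_eq)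
    then show "mplus M x y \<in> module_sum M S T" using x y cS cT module_sumI by simp
  next
    fix x assume "x \<in> module_sum M S T"
    then obtain s t where x: "s \<in> S" "t \<in> T" "x = mplus M s t" by (auto simp: module_sum_def)
    then have sc: "s \<in> carr M" "t \<in> carr M" using cS(1) cT(1) by auto
    have "mplus M x (mplus M (mminus M s) (mminus M t)) =
      mplus M (mplus M s (mminus M s)) (mplus M t (mminus M t))"
      using sc x(3) by (simp only: plus_ac plus_closed minus_closed)
    then have "mminus M x = mplus M (mminus M s) (mminus M t)"
      using sc x(3) by (metis eq_minus_iff minus_closed minus_right plus_closed zero_closed zero_left)
    then show "mminus M x \<in> module_sum M S T" using x cS cT module_sumI by simp
    fix r
    have "mscal M r x = mplus M (mscal M r s) (mscal M r t)" using sc x(3) scal_plus by simp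
    then show "mscal M r x \<in> module_sum M S T" using x cS cT module_sumI by simp
  qed
qed

text \<open>
  \<open>C\<close> is the closure of \<open>b\<close> under the module operations and under Skolem functions that
  give, for a formula \<open>\<phi>\<close> and a tuple \<open>c\<close>, a solution of one instance \<open>\<phi>(s + c)\<close> with \<open>s\<close> in \<open>S\<close>.
  The instances with the same \<open>c\<close> differ by instances of \<open>\<phi>\<close> in \<open>S\<close>, which have solutions in \<open>S\<close>.
\<close>

lemma small_pure_extension:
  assumes S: "closed_in M S" and SM: "le_Sigma lam \<Sigma> (induced M S) M" and b: "b \<in> carr M"
    and inf: "infinite (Field lam)" and R: "|UNIV :: 'r set| \<le>o |Field lam|"
  obtains C where "closed_in M C" "b \<in> C" "|C| \<le>o |Pow (Field lam)|"
    "le_Sigma lam \<Sigma> (induced M (module_sum M S C)) M"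
proof -
  let ?F = "Field lam"
  note cS = closed_inD[OF S]
  have pureS: "\<forall>\<phi>\<in>\<Sigma>. pure_for M lam \<phi> S" using SM le_Sigma_induced_iff[OF S] by blast
  obtain \<Sigma>' where \<Sigma>': "\<Sigma>' \<subseteq> \<Sigma>" "|\<Sigma>'| \<le>o |Pow ?F|"
    "\<And>\<phi>. \<phi> \<in> \<Sigma> \<Longrightarrow> \<exists>\<psi>\<in>\<Sigma>'. same_equations lam \<psi> \<phi>"
    using few_systems_of_equations[OF inf R] by metis
  define good where "good \<phi> c v \<longleftrightarrow> (\<forall>l\<in>?F. v l \<in> carr M) \<and>
    (\<exists>s. (\<forall>j<nfree \<phi>. s j \<in> S) \<and> solves M lam \<phi> v (\<lambda>j. mplus M (s j) (c ! j)))" for \<phi> c v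
  define wit where "wit \<phi> c = (if \<exists>v. good \<phi> c v then SOME v. good \<phi> c v else (\<lambda>_. b))" for \<phi> c
  have wit: "good \<phi> c (wit \<phi> c)" if "good \<phi> c v" for \<phi> c v
    unfolding wit_def using that someI[of "good \<phi> c" v] by auto
  have wit_carr: "wit \<phi> c l \<in> carr M" if "l \<in> ?F" for \<phi> c l
  proof (cases "\<exists>v. good \<phi> c v")
    case True
    then show ?thesis using wit that unfolding good_def by blast
  qed (simp add: wit_def b)
  \<comment> \<open>The operations to close under: \<open>Inl\<close> for the module, \<open>Inr\<close> for the components of the Skolem functions.\<close>
  define opr where "opr j xs = (case j of Inl s \<Rightarrow> (if length xs = mod_arity s then fn M s xs else b)
      | Inr (\<phi>, l) \<Rightarrow> wit \<phi> xs l)" for j :: "'r mod_sym + ('r, 'u) eformula \<times> 'u" and xs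
  define J :: "('r mod_sym + ('r, 'u) eformula \<times> 'u) set" where "J = Inl ` UNIV \<union> Inr ` (\<Sigma>' \<times> ?F)"
  have infP: "infinite (Pow ?F)" using inf by simp
  have FP: "|?F| \<le>o |Pow ?F|" by (rule ordLess_imp_ordLeq[OF card_of_Pow])
  have J: "|J| \<le>o |Pow ?F|"
    unfolding J_def
  proof (rule card_of_Un_ordLeq[OF infP])
    show "|Inl ` UNIV :: ('r mod_sym + ('r, 'u) eformula \<times> 'u) set| \<le>o |Pow ?F|"
      by (rule ordLeq_transitive[OF card_of_image card_of_mod_sym[OF infP ordLeq_transitive[OF R FP]]])
    show "|Inr ` (\<Sigma>' \<times> ?F) :: ('r mod_sym + ('r, 'u) eformula \<times> 'u) set| \<le>o |Pow ?F|"
      by (rule ordLeq_transitive[OF card_of_image card_of_Times_ordLeq[OF infP \<Sigma>'(2) FP]])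
  qed
  have bM: "{b} \<subseteq> carr M" and cb: "|{b}| \<le>o |Pow ?F|"
    using b card_of_finite_ordLeq[OF infP, of "{b}"] by simp_all
  have oprM: "opr j xs \<in> carr M" if "j \<in> J" "set xs \<subseteq> carr M" for j xs
    using that wit_carr fn_closed b by (auto simp: J_def opr_def)
  have "\<exists>C. {b} \<subseteq> C \<and> C \<subseteq> carr M \<and> |C| \<le>o |Pow ?F| \<and>
      (\<forall>j\<in>J. \<forall>xs. set xs \<subseteq> C \<longrightarrow> opr j xs \<in> C)"
    by (rule closure_under_finitary_operations[OF infP J bM cb, of opr], erule (1) oprM)
      (intro exI conjI ballI allI impI; assumption | simp)
  then obtain C where C: "{b} \<subseteq> C" "C \<subseteq> carr M" "|C| \<le>o |Pow ?F|"
    and cl: "\<And>j xs. j \<in> J \<Longrightarrow> set xs \<subseteq> C \<Longrightarrow> opr j xs \<in> C"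
    by (elim exE conjE) simp
  have clC: "closed_in M C"
    unfolding closed_in_def
  proof (intro conjI allI impI)
    fix s :: "'r mod_sym" and xs assume "length xs = mod_arity s \<and> set xs \<subseteq> C"
    then show "fn M s xs \<in> C" using cl[of "Inl s" xs] by (simp add: J_def opr_def)
  qed (fact C(2))
  have witC: "wit \<phi> c l \<in> C" if "\<phi> \<in> \<Sigma>'" "l \<in> ?F" "set c \<subseteq> C" for \<phi> c l
    using cl[of "Inr (\<phi>, l)" c] that by (simp add: J_def opr_def image_iff)
  let ?D = "module_sum M S C"
  note D = closed_in_module_sum[OF S clC]
  have DM: "?D \<subseteq> carr M" by (rule closed_inD(1)[OF D(1)])
  have pureD: "pure_for M lam \<phi> ?D" if \<phi>: "\<phi> \<in> \<Sigma>'" for \<phi>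
    unfolding pure_for_def
  proof (intro allI impI)
    fix y v
    assume y: "\<forall>j<nfree \<phi>. y j \<in> ?D" and v: "\<forall>l\<in>?F. v l \<in> carr M" and sol: "solves M lam \<phi> v y"
    have "\<forall>j. \<exists>s c. j < nfree \<phi> \<longrightarrow> s \<in> S \<and> c \<in> C \<and> y j = mplus M s c"
      using y unfolding module_sum_def by blast
    then obtain s c where sc: "\<And>j. j < nfree \<phi> \<Longrightarrow> s j \<in> S \<and> c j \<in> C \<and> y j = mplus M (s j) (c j)"
      by metis
    define cs where "cs = map c [0..<nfree \<phi>]"
    have cs: "set cs \<subseteq> C" "\<And>j. j < nfree \<phi> \<Longrightarrow> cs ! j = c j" using sc by (auto simp: cs_def)
    have scM: "s j \<in> carr M" "c j \<in> carr M" "y j \<in> carr M" if "j < nfree \<phi>" for j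
      using sc[OF that] cS(1) C(2) by (auto simp: subset_iff)
    have "solves M lam \<phi> v (\<lambda>j. mplus M (s j) (cs ! j))"
      using sol by (subst solves_cong[of _ _ v _ _ y]) (use v sc cs scM in auto)
    then have "good \<phi> cs v" unfolding good_def using v sc by blast
    from wit[OF this] obtain s0 where w: "\<forall>l\<in>?F. wit \<phi> cs l \<in> carr M" and s0: "\<forall>j<nfree \<phi>. s0 j \<in> S"
      and sol0: "solves M lam \<phi> (wit \<phi> cs) (\<lambda>j. mplus M (s0 j) (cs ! j))"
      unfolding good_def by blast
    \<comment> \<open>Subtracting the chosen instance leaves a system with parameters \<open>s1\<close> in \<open>S\<close>, which is solvable in \<open>S\<close>.\<close>
    define v1 where "v1 l = mplus M (v l) (mminus M (wit \<phi> cs l))" for l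
    define s1 where "s1 j = mplus M (s j) (mminus M (s0 j))" for j
    have s0M: "s0 j \<in> carr M" if "j < nfree \<phi>" for j using s0 that cS(1) by blast
    have v1: "\<forall>l\<in>?F. v1 l \<in> carr M" using v w by (simp add: v1_def)
    have s1: "\<forall>j<nfree \<phi>. s1 j \<in> S" using s0 sc cS by (simp add: s1_def)
    have back_v: "mplus M (v1 l) (wit \<phi> cs l) = v l" if "l \<in> ?F" for l
      using that v w by (simp add: v1_def plus_assoc)
    have back_y: "mplus M (s1 j) (mplus M (s0 j) (cs ! j)) = y j" if "j < nfree \<phi>" for j
    proof -
      have "mplus M (s1 j) (mplus M (s0 j) (cs ! j)) =
        mplus M (mplus M (s j) (mplus M (mminus M (s0 j)) (s0 j))) (c j)"
        using scM[OF that] s0M[OF that] cs(2)[OF that]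
        by (simp only: s1_def plus_assoc plus_closed minus_closed)
      then show ?thesis using scM[OF that] s0M[OF that] sc[OF that] by simp
    qed
    have add: "lhs M lam \<phi> (\<lambda>l. mplus M (u l) (wit \<phi> cs l)) (\<lambda>j. mplus M (s1 j) (mplus M (s0 j) (cs ! j))) i
      = lhs M lam \<phi> u s1 i" if "\<forall>l\<in>?F. u l \<in> carr M" "i \<in> ?F" for u i
    proof -
      have "lhs M lam \<phi> u s1 i \<in> carr M"
        by (rule lhs_closed) (use that s1 cS(1) in auto)
      then show ?thesis
        using sol0 that(2) scM s0M cs(2) s1 cS(1)
        by (subst lhs_plus) (use w that(1) in \<open>auto simp: solves_def\<close>)
    qed
    have "solves M lam \<phi> v1 s1"
    proof -
      have "solves M lam \<phi> (\<lambda>l. mplus M (v1 l) (wit \<phi> cs l)) (\<lambda>j. mplus M (s1 j) (mplus M (s0 j) (cs ! j)))"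
        using sol by (subst solves_cong[of _ _ v _ _ y]) (use v back_v back_y scM in auto)
      then show ?thesis using add[OF v1] by (simp add: solves_def)
    qed
    then obtain u where u: "\<forall>l\<in>?F. u l \<in> S" "solves M lam \<phi> u s1"
      using pureS \<phi> \<Sigma>'(1) s1 v1 unfolding pure_for_def by blast
    then have uM: "\<forall>l\<in>?F. u l \<in> carr M" using cS(1) by blast
    let ?w = "\<lambda>l. mplus M (u l) (wit \<phi> cs l)"
    have "solves M lam \<phi> ?w (\<lambda>j. mplus M (s1 j) (mplus M (s0 j) (cs ! j)))"
      using add[OF uM] u(2) by (simp add: solves_def)
    then have "solves M lam \<phi> ?w y"
      by (subst (asm) solves_cong[of _ _ ?w _ _ y]) (use uM w back_y scM in auto)
    moreover have "\<forall>l\<in>?F. ?w l \<in> ?D" using u(1) witC[OF \<phi> _ cs(1)] module_sumI by blast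
    ultimately show "\<exists>w. (\<forall>l\<in>?F. w l \<in> ?D) \<and> solves M lam \<phi> w y"
      by (intro exI[of _ ?w] conjI)
  qed
  have "\<forall>\<phi>\<in>\<Sigma>. pure_for M lam \<phi> ?D"
    using \<Sigma>'(3) pureD same_equations_pure[OF _ DM] by blast
  then have "le_Sigma lam \<Sigma> (induced M ?D) M" using le_Sigma_induced_iff[OF D(1)] by blast
  with clC C that show thesis by blast
qed

end

section \<open>Sums over a common submodule\<close>

text \<open>
  A code for the quantifier-free type over \<open>A\<close> of the family \<open>e\<close>: all relations of the form
  \<open>a + r e(t'') = e(t) + e(t')\<close>.  When the image of \<open>e\<close> is a submodule, this one shape of relation
  expresses the addition and scalar multiplication of that submodule as well as the equations
  between elements of the sum with \<open>A\<close> (\<open>qf_type_operations\<close>).  It determines \<open>a\<close> from the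
  other data, which keeps the number of codes small.
\<close>

definition qf_type_over ::
  "('r :: {ring, monoid_mult}, 'u) modstr \<Rightarrow> ('r, 'u) modstr \<Rightarrow> 't set \<Rightarrow> ('t \<Rightarrow> 'u) \<Rightarrow>
   (('t \<times> 't \<times> 't \<times> 'r) \<times> 'u) set" where
  "qf_type_over A B T e =
     {((t, t', t'', r), a). t \<in> T \<and> t' \<in> T \<and> t'' \<in> T \<and> a \<in> carr A \<and>
        mplus B a (mscal B r (e t'')) = mplus B (e t) (e t')}"

lemma qf_type_single_valued:
  assumes AB: "submodule A B" and e: "e ` T \<subseteq> carr B"
  shows "single_valued (qf_type_over A B T e)"
proof -
  interpret B: rmodule B using AB by unfold_locales (simp add: submodule_def)
  have AcB: "carr A \<subseteq> carr B" using closed_in_submodule(1)[OF AB] by (simp add: closed_in_def)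
  show ?thesis
  proof (rule single_valuedI)
    fix q a b
    assume a: "(q, a) \<in> qf_type_over A B T e" and b: "(q, b) \<in> qf_type_over A B T e"
    obtain t t' t'' r where q: "q = (t, t', t'', r)" by (cases q) auto
    have "a \<in> carr B" "b \<in> carr B" "e t'' \<in> carr B"
      and "mplus B a (mscal B r (e t'')) = mplus B b (mscal B r (e t''))"
      using a b AcB e unfolding q by (auto simp: qf_type_over_def)
    then show "a = b" using B.plus_right_cancel[of "mscal B r (e t'')" a b] by simp
  qed
qed

lemma submodule_ops:
  assumes "submodule A B"
  shows "mzero B = mzero A" "a \<in> carr A \<Longrightarrow> a' \<in> carr A \<Longrightarrow> mplus B a a' = mplus A a a'"
    "a \<in> carr A \<Longrightarrow> mminus B a = mminus A a" "a \<in> carr A \<Longrightarrow> mscal B r a = mscal A r a"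
proof -
  have *: "fn A s xs = fn B s xs" if "set xs \<subseteq> carr A" for s xs
    using closed_in_submodule(2)[OF assms] fn_induced[OF that] by metis
  show "mzero B = mzero A" "a \<in> carr A \<Longrightarrow> a' \<in> carr A \<Longrightarrow> mplus B a a' = mplus A a a'"
    "a \<in> carr A \<Longrightarrow> mminus B a = mminus A a" "a \<in> carr A \<Longrightarrow> mscal B r a = mscal A r a"
    by (simp_all add: *)
qed

lemma qf_type_operations:
  assumes AB: "submodule A B" and C: "closed_in B (e ` T)"
    and t: "t \<in> T" "t' \<in> T" "t'' \<in> T"
  shows "e t = mzero B \<longleftrightarrow> ((t, t, t, 1), mzero A) \<in> qf_type_over A B T e"
    and "mplus B (e t) (e t') = e t'' \<longleftrightarrow> ((t, t', t'', 1), mzero A) \<in> qf_type_over A B T e"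
    and "e t' = mzero B \<Longrightarrow>
      mscal B r (e t'') = e t \<longleftrightarrow> ((t, t', t'', r), mzero A) \<in> qf_type_over A B T e"
    and "e t'' = mzero B \<Longrightarrow> a \<in> carr A \<Longrightarrow> a' \<in> carr A \<Longrightarrow>
      mplus B a (e t) = mplus B a' (e t') \<longleftrightarrow>
        ((t', t'', t, 1), mplus A a (mminus A a')) \<in> qf_type_over A B T e"
proof -
  interpret A: rmodule A using AB by unfold_locales (simp add: submodule_def)
  interpret B: rmodule B using AB by unfold_locales (simp add: submodule_def)
  have AcB: "carr A \<subseteq> carr B" using closed_in_submodule(1)[OF AB] by (simp add: closed_in_def)
  have e: "e t \<in> carr B" "e t' \<in> carr B" "e t'' \<in> carr B"
    using closed_inD(1)[OF C] t by auto
  note z = submodule_ops(1)[OF AB, symmetric]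
  have zA: "mzero B \<in> carr A" using A.zero_closed unfolding z .
  show "e t = mzero B \<longleftrightarrow> ((t, t, t, 1), mzero A) \<in> qf_type_over A B T e"
    using e t zA B.plus_eq_self_iff[of "e t" "e t"] by (auto simp: qf_type_over_def z)
  show "mplus B (e t) (e t') = e t'' \<longleftrightarrow> ((t, t', t'', 1), mzero A) \<in> qf_type_over A B T e"
    using e t zA by (auto simp: qf_type_over_def z)
  show "mscal B r (e t'') = e t \<longleftrightarrow> ((t, t', t'', r), mzero A) \<in> qf_type_over A B T e"
    if "e t' = mzero B"
    using e t that zA by (auto simp: qf_type_over_def z)
  show "mplus B a (e t) = mplus B a' (e t') \<longleftrightarrow>
      ((t', t'', t, 1), mplus A a (mminus A a')) \<in> qf_type_over A B T e"
    if t'': "e t'' = mzero B" and a: "a \<in> carr A" "a' \<in> carr A"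
  proof -
    let ?d = "mplus A a (mminus A a')"
    have d: "?d \<in> carr A" "?d \<in> carr B" using a AcB by auto
    have aB: "a \<in> carr B" "a' \<in> carr B" using a AcB by auto
    have "mplus A a' ?d = mplus A a (mplus A a' (mminus A a'))"
      using a by (simp only: A.plus_left_commute A.minus_closed)
    then have "mplus B a' ?d = a"
      using submodule_ops(2)[OF AB a(2) d(1)] a by simp
    then have "mplus B a (e t) = mplus B a' (mplus B ?d (e t))"
      using B.plus_assoc[OF aB(2) d(2) e(1)] by simp
    then have "mplus B a (e t) = mplus B a' (e t') \<longleftrightarrow> mplus B ?d (e t) = e t'"
      using B.plus_left_cancel[of a' "mplus B ?d (e t)" "e t'"] aB d e by simp
    then show ?thesis using t e d t'' by (auto simp: qf_type_over_def)
  qed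
qed

text \<open>
  The isomorphism sends \<open>a + e1(t)\<close> to \<open>a + e2(t)\<close>.  That it is well defined and injective, and
  that it respects the operations, are statements about the coded relations.
\<close>

lemma sum_isomorphic_if_same_qf_type:
  fixes A B1 B2 :: "('r :: {ring, monoid_mult}, 'u) modstr"
  assumes AB1: "submodule A B1" and C1: "closed_in B1 (e1 ` T)"
    and AB2: "submodule A B2" and C2: "closed_in B2 (e2 ` T)"
    and same: "qf_type_over A B1 T e1 = qf_type_over A B2 T e2"
  obtains f where
    "isomorphism mod_lang f (induced B1 (module_sum B1 (carr A) (e1 ` T)))
       (induced B2 (module_sum B2 (carr A) (e2 ` T)))"
    "\<And>a. a \<in> carr A \<Longrightarrow> f a = a" "\<And>t. t \<in> T \<Longrightarrow> f (e1 t) = e2 t"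
proof -
  interpret A: rmodule A using AB1 by unfold_locales (simp add: submodule_def)
  interpret B1: rmodule B1 using AB1 by unfold_locales (simp add: submodule_def)
  interpret B2: rmodule B2 using AB2 by unfold_locales (simp add: submodule_def)
  note A1 = closed_in_submodule(1)[OF AB1] and A2 = closed_in_submodule(1)[OF AB2]
  let ?D1 = "module_sum B1 (carr A) (e1 ` T)" and ?D2 = "module_sum B2 (carr A) (e2 ` T)"
  note D1 = B1.closed_in_module_sum[OF A1 C1] and D2 = B2.closed_in_module_sum[OF A2 C2]
  note q1 = qf_type_operations[OF AB1 C1] and q2 = qf_type_operations[OF AB2 C2]
  \<comment> \<open>Putting an index of zero into a slot turns the three-term relations into two-term ones.\<close>
  obtain z where z: "z \<in> T" "e1 z = mzero B1" using closed_inD(2)[OF C1] by force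
  have z2: "e2 z = mzero B2" using z q1(1)[of z] q2(1)[of z] same by simp
  have A1c: "a \<in> carr B1" and A2c: "a \<in> carr B2" if "a \<in> carr A" for a
    using that closed_inD(1)[OF A1] closed_inD(1)[OF A2] by auto
  have e1c: "e1 t \<in> carr B1" and e2c: "e2 t \<in> carr B2" if "t \<in> T" for t
    using that closed_inD(1)[OF C1] closed_inD(1)[OF C2] by auto
  have transfer: "mplus B1 a (e1 t) = mplus B1 a' (e1 t') \<longleftrightarrow> mplus B2 a (e2 t) = mplus B2 a' (e2 t')"
    if "a \<in> carr A" "a' \<in> carr A" "t \<in> T" "t' \<in> T" for a a' t t'
    using q1(4)[of t t' z a a'] q2(4)[of t t' z a a'] that z z2 same by simp
  have "\<forall>x. \<exists>a t. x \<in> ?D1 \<longrightarrow> a \<in> carr A \<and> t \<in> T \<and> x = mplus B1 a (e1 t)"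
    unfolding module_sum_def by blast
  then obtain \<alpha> \<tau> where rep: "\<And>x. x \<in> ?D1 \<Longrightarrow> \<alpha> x \<in> carr A \<and> \<tau> x \<in> T \<and> x = mplus B1 (\<alpha> x) (e1 (\<tau> x))"
    by metis
  define f where "f x = mplus B2 (\<alpha> x) (e2 (\<tau> x))" for x
  have inD1: "mplus B1 a (e1 t) \<in> ?D1" and inD2: "mplus B2 a (e2 t) \<in> ?D2"
    if "a \<in> carr A" "t \<in> T" for a t
    using that by (auto simp: module_sum_def)
  have f: "f (mplus B1 a (e1 t)) = mplus B2 a (e2 t)" if "a \<in> carr A" "t \<in> T" for a t
    using transfer[of a "\<alpha> (mplus B1 a (e1 t))" t "\<tau> (mplus B1 a (e1 t))"] rep[OF inD1[OF that]] that
    unfolding f_def by simp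
  have fA: "f a = a" if "a \<in> carr A" for a
    using f[of a z] that z z2 A1c A2c by simp
  have fe: "f (e1 t) = e2 t" if "t \<in> T" for t
    using f[of "mzero A" t] that e1c e2c submodule_ops(1)[OF AB1] submodule_ops(1)[OF AB2]
      A.zero_closed B1.zero_left B2.zero_left by metis
  have f_zero: "f (mzero B1) = mzero B2"
    using fA[of "mzero A"] submodule_ops(1)[OF AB1] submodule_ops(1)[OF AB2] by simp
  have D1c: "x \<in> carr B1" if "x \<in> ?D1" for x using that closed_inD(1)[OF D1(1)] by blast
  have D2c: "x \<in> carr B2" if "x \<in> ?D2" for x using that closed_inD(1)[OF D2(1)] by blast
  have fD: "f x \<in> ?D2" if "x \<in> ?D1" for x
    using rep[OF that] inD2 unfolding f_def by blast
  have inj: "inj_on f ?D1"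
  proof (rule inj_onI)
    fix x y assume x: "x \<in> ?D1" and y: "y \<in> ?D1" and "f x = f y"
    then show "x = y"
      using transfer[of "\<alpha> x" "\<alpha> y" "\<tau> x" "\<tau> y"] rep[OF x] rep[OF y] unfolding f_def by simp
  qed
  have surj: "f ` ?D1 = ?D2"
  proof
    show "?D2 \<subseteq> f ` ?D1"
    proof
      fix y assume "y \<in> ?D2"
      then obtain a t where "a \<in> carr A" "t \<in> T" "y = mplus B2 a (e2 t)"
        by (auto simp: module_sum_def)
      then show "y \<in> f ` ?D1" using f[of a t] inD1[of a t] by force
    qed
  qed (use fD in blast)
  have f_plus: "f (mplus B1 x y) = mplus B2 (f x) (f y)" if x: "x \<in> ?D1" and y: "y \<in> ?D1" for x y
  proof -
    obtain a t where a: "a \<in> carr A" "t \<in> T" "x = mplus B1 a (e1 t)" using rep[OF x] by blast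
    obtain b s where b: "b \<in> carr A" "s \<in> T" "y = mplus B1 b (e1 s)" using rep[OF y] by blast
    obtain u where u: "u \<in> T" "mplus B1 (e1 t) (e1 s) = e1 u"
      using closed_inD(3)[OF C1, of "e1 t" "e1 s"] a b by auto
    then have u2: "mplus B2 (e2 t) (e2 s) = e2 u"
      using q1(2)[of t s u] q2(2)[of t s u] a b same by simp
    have ab: "mplus A a b \<in> carr A" using a b by simp
    have "mplus B1 x y = mplus B1 (mplus B1 a b) (mplus B1 (e1 t) (e1 s))"
      using a b A1c e1c by (simp add: B1.plus_ac)
    also have "\<dots> = mplus B1 (mplus A a b) (e1 u)"
      using a b u submodule_ops(2)[OF AB1] by simp
    finally have "f (mplus B1 x y) = mplus B2 (mplus A a b) (e2 u)"
      using f[OF ab u(1)] by simp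
    also have "\<dots> = mplus B2 (mplus B2 a b) (mplus B2 (e2 t) (e2 s))"
      using a b u2 submodule_ops(2)[OF AB2] by simp
    also have "\<dots> = mplus B2 (mplus B2 a (e2 t)) (mplus B2 b (e2 s))"
      using a b A2c e2c by (simp add: B2.plus_ac)
    finally show ?thesis using a b f by simp
  qed
  have f_scal: "f (mscal B1 r x) = mscal B2 r (f x)" if x: "x \<in> ?D1" for x r
  proof -
    obtain a t where a: "a \<in> carr A" "t \<in> T" "x = mplus B1 a (e1 t)" using rep[OF x] by blast
    obtain u where u: "u \<in> T" "mscal B1 r (e1 t) = e1 u"
      using closed_inD(5)[OF C1, of "e1 t" r] a by auto
    then have u2: "mscal B2 r (e2 t) = e2 u"
      using q1(3)[of u z t r] q2(3)[of u z t r] a z z2 same by simp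
    have ra: "mscal A r a \<in> carr A" using a by simp
    have "mscal B1 r x = mplus B1 (mscal A r a) (e1 u)"
      using a u A1c e1c submodule_ops(4)[OF AB1] B1.scal_plus by simp
    then have "f (mscal B1 r x) = mplus B2 (mscal A r a) (e2 u)"
      using f[OF ra u(1)] by simp
    also have "\<dots> = mscal B2 r (mplus B2 a (e2 t))"
      using a u2 A2c e2c submodule_ops(4)[OF AB2] B2.scal_plus by simp
    finally show ?thesis using a f by simp
  qed
  have f_minus: "f (mminus B1 x) = mminus B2 (f x)" if x: "x \<in> ?D1" for x
  proof -
    have m: "mminus B1 x \<in> ?D1" by (rule closed_inD(4)[OF D1(1) x])
    have "mplus B2 (f x) (f (mminus B1 x)) = mzero B2"
      using f_plus[OF x m] f_zero D1c[OF x] by simp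
    then show ?thesis using B2.eq_minus_iff[OF D2c[OF fD[OF x]] D2c[OF fD[OF m]]] by simp
  qed
  have "embedding mod_lang f (induced B1 ?D1) (induced B2 ?D2)"
    unfolding embedding_def
  proof (intro conjI ballI allI impI)
    show "is_str mod_lang (induced B1 ?D1)" "is_str mod_lang (induced B2 ?D2)"
      using B1.submodule_induced[OF D1(1)] B2.submodule_induced[OF D2(1)]
      by (simp_all add: submodule_def substructure_def)
    show "f ` carr (induced B1 ?D1) \<subseteq> carr (induced B2 ?D2)" "inj_on f (carr (induced B1 ?D1))"
      using surj inj by simp_all
  next
    fix s :: "'r mod_sym" and xs
    assume "length xs = farity mod_lang s \<and> set xs \<subseteq> carr (induced B1 ?D1)"
    then have xs: "length xs = mod_arity s" "set xs \<subseteq> ?D1" by (simp_all add: mod_lang_def)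
    have "set (map f xs) \<subseteq> ?D2" using xs(2) fD by auto
    then have "fn (induced B2 ?D2) s (map f xs) = fn B2 s (map f xs)" by (rule fn_induced)
    moreover have "f (fn B1 s xs) = fn B2 s (map f xs)"
    proof (cases s)
      case Plus
      then obtain x y where "xs = [x, y]" using xs(1) by (auto simp: length_Suc_conv numeral_2_eq_2)
      then show ?thesis using xs Plus f_plus by simp
    qed (use xs f_zero f_scal f_minus in \<open>auto simp: length_Suc_conv\<close>)
    ultimately show "f (fn (induced B1 ?D1) s xs) = fn (induced B2 ?D2) s (map f xs)"
      using xs(2) by simp
  qed (simp_all add: mod_lang_def)
  then have "isomorphism mod_lang f (induced B1 ?D1) (induced B2 ?D2)"
    using surj by (simp add: isomorphism_def)
  then show thesis using fA fe that by blast
qed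

section \<open>Galois types\<close>

lemma E_at_sym: "E_at L K prec t1 t2 \<Longrightarrow> E_at L K prec t2 t1"
  unfolding E_at_def by (auto split: prod.splits) metis+

lemma gtp_eqI:
  assumes "E_at L K prec (b1, X1, A1) (b2, X2, A2)"
  shows "gtp L K prec b1 X1 A1 = gtp L K prec b2 X2 A2"
  unfolding gtp_def using assms E_at_sym[OF assms]
  by (auto intro: tranclp_into_tranclp2)

context aec
begin

lemma strong_embedding_id:
  assumes "prec A C"
  shows "strong_embedding L prec (\<lambda>x. x) A C"
proof -
  have s: "is_str L A" "is_str L C" "carr A \<subseteq> carr C" "A = induced C (carr A)"
    using prec_substructure[OF assms] by (simp_all add: substructure_def)
  have "fn A g xs = fn C g xs" "rl A p xs = rl C p xs" if "set xs \<subseteq> carr A" for g p xs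
    by (subst s(4), simp add: induced_def that)+
  then show ?thesis
    using s assms by (simp add: strong_embedding_def embedding_def)
qed

lemma gtp_substructure:
  assumes DB: "prec D B" and X: "X \<subseteq> carr D" and b: "b \<in> carr D"
  shows "gtp L K prec (\<lambda>_ :: unit. b) X D = gtp L K prec (\<lambda>_. b) X B"
proof (rule gtp_eqI)
  have DB': "D \<in> K" "B \<in> K" "carr D \<subseteq> carr B"
    using DB prec_K prec_substructure by (auto simp: substructure_def)
  then show "E_at L K prec (\<lambda>_ :: unit. b, X, D) (\<lambda>_. b, X, B)"
    unfolding E_at_def
    using X b strong_embedding_id[OF DB] strong_embedding_id[OF prec_refl[OF DB'(2)]]
    by (simp, intro conjI bexI[of _ B] exI[of _ "\<lambda>x. x"]) auto
qed

text \<open>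
  The target of the isomorphism serves as the common extension.
\<close>

lemma gtp_isomorphism:
  assumes f: "isomorphism L f D1 D2" and D: "D1 \<in> K" "D2 \<in> K"
    and X: "X \<subseteq> carr D1" "\<And>x. x \<in> X \<Longrightarrow> f x = x" and b: "b \<in> carr D1"
  shows "gtp L K prec (\<lambda>_ :: unit. b) X D1 = gtp L K prec (\<lambda>_. f b) X D2"
proof (rule gtp_eqI)
  have img: "f ` carr D1 = carr D2" and emb: "embedding L f D1 D2"
    using f by (simp_all add: isomorphism_def)
  have refl: "prec D2 D2" by (rule prec_refl[OF D(2)])
  then have "induced D2 (carr D2) = D2"
    using prec_substructure by (auto simp: substructure_def)
  then have "strong_embedding L prec f D1 D2"
    using emb img refl by (simp add: strong_embedding_def)
  moreover have "X \<subseteq> carr D2"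
    using X img by force
  ultimately show "E_at L K prec (\<lambda>_ :: unit. b, X, D1) (\<lambda>_. f b, X, D2)"
    unfolding E_at_def
    using X b D img strong_embedding_id[OF refl]
    by (simp, intro conjI bexI[of _ D2] exI[of _ f] exI[of _ "\<lambda>x. x"]) auto
qed

text \<open>
  The least bound in the definition of \<open>LS\<close> exists because cardinals are well-ordered.
\<close>

lemma LS_bound_LS: "LS_bound L K prec (LS L K prec)"
proof -
  have "\<exists>lam. LS_bound L K prec lam \<and> (\<forall>\<kappa>. LS_bound L K prec \<kappa> \<longrightarrow> lam \<le>o \<kappa>)"
  proof -
    have "\<forall>r\<in>Collect (LS_bound L K prec). Card_order r"
      by (simp add: LS_bound_def small_cardinal_def)
    then show ?thesis
      using exists_minim_Card_order[of "Collect (LS_bound L K prec)"] Loewenheim_Skolem by auto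
  qed
  then show ?thesis unfolding LS_def by (rule someI2_ex) blast
qed

end

section \<open>Counting Galois types\<close>

locale submodule_closed_E_nice_aec = aec mod_lang K "restrict_rel K prec"
  for K :: "('r :: {ring, monoid_mult}, 'u) modstr set" and prec +
  fixes lam :: "'u rel" and \<Sigma>
  assumes nice: "A \<in> RMod \<Longrightarrow> B \<in> RMod \<Longrightarrow> prec A B \<longleftrightarrow> le_Sigma lam \<Sigma> A B"
    and inf: "infinite (Field lam)" and R: "|UNIV :: 'r set| \<le>o |Field lam|"
    and K: "K \<subseteq> RMod"
    and sub: "submodule A B \<Longrightarrow> B \<in> K \<Longrightarrow> A \<in> K"
begin

text \<open>
  The small module is given by an enumeration along a fixed index set \<open>T\<close>, so that families in
  different extensions of \<open>A\<close> can be compared.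
\<close>

lemma Galois_type_from_small_module:
  fixes T :: "'t set"
  assumes T: "|Pow (Field lam)| \<le>o |T|" and AB: "restrict_rel K prec A B" and b: "b \<in> carr B"
  obtains e t where "closed_in B (e ` T)" "t \<in> T" "e t = b"
    "induced B (module_sum B (carr A) (e ` T)) \<in> K"
    "gtp mod_lang K (restrict_rel K prec) (\<lambda>_ :: unit. b) (carr A) B =
     gtp mod_lang K (restrict_rel K prec) (\<lambda>_. b) (carr A)
       (induced B (module_sum B (carr A) (e ` T)))"
proof -
  have AK: "A \<in> K" "B \<in> K" "prec A B" using AB by (simp_all add: restrict_rel_def)
  then have AR: "A \<in> RMod" "B \<in> RMod" using K by auto
  interpret B: rmodule B using AR by unfold_locales
  have le: "le_Sigma lam \<Sigma> A B" using nice[OF AR] AK by simp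
  then have AsB: "submodule A B" by (simp add: le_Sigma_def)
  note A = closed_in_submodule[OF AsB]
  obtain C where C: "closed_in B C" "b \<in> C" "|C| \<le>o |Pow (Field lam)|"
    and leC: "le_Sigma lam \<Sigma> (induced B (module_sum B (carr A) C)) B"
    using B.small_pure_extension[OF A(1) _ b inf R, of \<Sigma>] le A(2) by metis
  have "|C| \<le>o |T|" by (rule ordLeq_transitive[OF C(3) T])
  then obtain e where e: "e ` T = C" using card_of_ordLeq2[of C T] C(2) by blast
  let ?D = "module_sum B (carr A) C"
  note D = B.closed_in_module_sum[OF A(1) C(1)]
  have DK: "induced B ?D \<in> K" using sub[OF B.submodule_induced[OF D(1)] AK(2)] .
  then have "restrict_rel K prec (induced B ?D) B"
    using nice leC K AK AR by (auto simp: restrict_rel_def)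
  then have "gtp mod_lang K (restrict_rel K prec) (\<lambda>_ :: unit. b) (carr A) (induced B ?D) =
     gtp mod_lang K (restrict_rel K prec) (\<lambda>_. b) (carr A) B"
    by (rule gtp_substructure) (use D C in auto)
  moreover obtain t where "t \<in> T" "e t = b" using e C(2) by auto
  ultimately show thesis using that[of e t] C(1) DK e by simp
qed

text \<open>
  A type is coded by the quantifier-free type of an enumeration together with the index of the
  realisation; types with the same code are equal because the isomorphism of the two sums fixes
  \<open>A\<close> and matches the realisations.
\<close>

lemma few_Galois_types:
  fixes X :: "'x set"
  assumes X: "|Pow (Field lam)| \<le>o |X|" and A: "|carr A| \<le>o |Pow X|"
  shows "|galois_types mod_lang K (restrict_rel K prec) A| \<le>o |Pow X|"
proof -
  let ?prec = "restrict_rel K prec"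
  let ?gtp = "\<lambda>b B. gtp mod_lang K ?prec (\<lambda>_ :: unit. b) (carr A) B"
  define T where "T = Pow (Field lam)"
  let ?codes = "T \<times> {q. q \<subseteq> (T \<times> T \<times> T \<times> (UNIV :: 'r set)) \<times> carr A \<and> single_valued q}"
  define codes where "codes p c \<longleftrightarrow> (\<exists>B e t. submodule A B \<and> closed_in B (e ` T) \<and> t \<in> T \<and>
    induced B (module_sum B (carr A) (e ` T)) \<in> K \<and>
    p = ?gtp (e t) (induced B (module_sum B (carr A) (e ` T))) \<and>
    c = (t, qf_type_over A B T e))" for p c
  have ex: "\<exists>c. codes p c" if p_type: "p \<in> galois_types mod_lang K ?prec A" for p
  proof -
    obtain b B where p: "p = ?gtp b B" and B: "?prec A B" "b \<in> carr B"
      using p_type by (auto simp: galois_types_def)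
    have AsB: "submodule A B" using B(1) nice K by (auto simp: restrict_rel_def le_Sigma_def)
    have "|Pow (Field lam)| \<le>o |T|" unfolding T_def by (rule ordLeq_refl[OF card_of_Card_order])
    from Galois_type_from_small_module[OF this B]
    show ?thesis using AsB p unfolding codes_def by metis
  qed
  have range: "c \<in> ?codes" if cp: "codes p c" for p c
  proof -
    obtain B and e :: "'u set \<Rightarrow> 'u" and t where B: "submodule A B" "closed_in B (e ` T)" "t \<in> T" "c = (t, qf_type_over A B T e)"
      using cp unfolding codes_def by blast
    then show ?thesis
      using qf_type_single_valued[OF B(1), of e T] closed_inD(1)[OF B(2)]
      by (auto simp: qf_type_over_def)
  qed
  have uniq: "p = p'" if cp: "codes p c" and cp': "codes p' c" for p p' c
  proof -
    obtain B e t where B: "submodule A B" "closed_in B (e ` T)" "t \<in> T"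
        "induced B (module_sum B (carr A) (e ` T)) \<in> K"
      and p: "p = ?gtp (e t) (induced B (module_sum B (carr A) (e ` T)))"
      and c: "c = (t, qf_type_over A B T e)"
      using cp unfolding codes_def by blast
    obtain B' e' where B': "submodule A B'" "closed_in B' (e' ` T)"
        "induced B' (module_sum B' (carr A) (e' ` T)) \<in> K"
      and p': "p' = ?gtp (e' t) (induced B' (module_sum B' (carr A) (e' ` T)))"
      and c': "qf_type_over A B T e = qf_type_over A B' T e'"
      using cp' unfolding codes_def c by blast
    obtain f where f: "isomorphism mod_lang f (induced B (module_sum B (carr A) (e ` T)))
        (induced B' (module_sum B' (carr A) (e' ` T)))"
      and fA: "\<And>a. a \<in> carr A \<Longrightarrow> f a = a" and fe: "\<And>t. t \<in> T \<Longrightarrow> f (e t) = e' t"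
      using sum_isomorphic_if_same_qf_type[OF B(1,2) B'(1,2) c'] by blast
    interpret B: rmodule B using B(1) by unfold_locales (simp add: submodule_def)
    note D = B.closed_in_module_sum[OF closed_in_submodule(1)[OF B(1)] B(2)]
    have "?gtp (e t) (induced B (module_sum B (carr A) (e ` T))) =
      ?gtp (f (e t)) (induced B' (module_sum B' (carr A) (e' ` T)))"
      by (rule gtp_isomorphism[OF f B(4) B'(3)]) (use D B(3) fA in auto)
    then show ?thesis using p p' fe[OF B(3)] by simp
  qed
  define code where "code p = (SOME c. codes p c)" for p
  have code: "codes p (code p)" if "p \<in> galois_types mod_lang K ?prec A" for p
    unfolding code_def using ex[OF that] by (rule someI_ex)
  have inj: "inj_on code (galois_types mod_lang K ?prec A)"
    by (rule inj_onI) (metis code uniq)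
  have img: "code ` galois_types mod_lang K ?prec A \<subseteq> ?codes"
    using code range by blast
  have infP: "infinite (Pow (Field lam))" using inf by simp
  have infX: "infinite X" using X card_of_ordLeq_infinite infP by blast
  have infPX: "infinite (Pow X)" using infX by simp
  have T: "|T| \<le>o |X|" unfolding T_def by (rule X)
  have XP: "|X| \<le>o |Pow X|" by (rule ordLess_imp_ordLeq[OF card_of_Pow])
  have FX: "|Field lam| \<le>o |X|" by (rule ordLeq_transitive[OF ordLess_imp_ordLeq[OF card_of_Pow] X])
  have "|T \<times> T \<times> T \<times> (UNIV :: 'r set)| \<le>o |X|"
    by (intro card_of_Times_ordLeq[OF infX] T ordLeq_transitive[OF R FX])
  then have codes_le: "|?codes| \<le>o |Pow X|"
    by (intro card_of_Times_ordLeq[OF infPX] ordLeq_transitive[OF T XP]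
        card_of_partial_functions[OF infX] A)
  have "|galois_types mod_lang K ?prec A| \<le>o |?codes|"
    by (rule iffD1[OF card_of_ordLeq exI[of _ code]]) (intro conjI inj img)
  then show ?thesis by (rule ordLeq_transitive[OF _ codes_le])
qed

end

text \<open>
  The closure of the universe under powersets, transferred to sets of other types.
\<close>

lemma universe_powerset:
  fixes X :: "'x set"
  assumes U: "universe TYPE('u)" and X: "|X| <o |UNIV :: 'u set|"
  shows "|Pow X| <o |UNIV :: 'u set|"
proof -
  obtain f where f: "inj_on f X" "f ` X \<subseteq> (UNIV :: 'u set)"
    using card_of_ordLeq[of X "UNIV :: 'u set"] ordLess_imp_ordLeq[OF X] by blast
  have "|f ` X| <o |UNIV :: 'u set|" by (rule ordLeq_ordLess_trans[OF card_of_image X])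
  then have "|Pow (f ` X)| <o |UNIV :: 'u set|" using U by (simp add: universe_def)
  moreover have "|X| \<le>o |f ` X|" using card_of_ordLeq[of X "f ` X"] f(1) by blast
  ultimately show ?thesis by (rule ordLeq_ordLess_trans[OF card_of_Pow_mono, rotated])
qed

lemma universe_infinite:
  assumes "universe TYPE('u)"
  shows "infinite (UNIV :: 'u set)"
proof -
  have "natLeq \<le>o |UNIV :: 'u set|"
    using assms by (simp add: universe_def ordLess_imp_ordLeq)
  then show ?thesis using infinite_iff_natLeq_ordLeq[of "UNIV :: 'u set"] by blast
qed

lemma small_cardinal_Field: "small_cardinal (\<kappa> :: 'u rel) \<Longrightarrow> |Field \<kappa>| <o |UNIV :: 'u set|"
  unfolding small_cardinal_def by (metis card_of_Field_ordIso ordIso_ordLess_trans)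

theorem theorem4p38:
  fixes prec :: "('r :: {ring, monoid_mult}, 'u) modstr \<Rightarrow> ('r, 'u) modstr \<Rightarrow> bool"
    and K :: "('r, 'u) modstr set"
  assumes "universe TYPE('u)"
    and "E_nice prec"
    and "K \<subseteq> RMod"
    and "aec mod_lang K (restrict_rel K prec)"
    and "\<And>A B. submodule A B \<Longrightarrow> B \<in> K \<Longrightarrow> A \<in> K"
  shows "aec_stable mod_lang K (restrict_rel K prec)"
  unfolding aec_stable_def
proof (intro allI impI)
  fix \<kappa> :: "'u rel" assume \<kappa>: "small_cardinal \<kappa>"
  let ?prec = "restrict_rel K prec"
  let ?U = "UNIV :: 'u set"
  obtain lam :: "'u rel" and \<Sigma> where lam: "small_cardinal lam" "cinfinite lam" "|UNIV :: 'r set| \<le>o lam"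
    and nice: "\<And>A B. A \<in> RMod \<Longrightarrow> B \<in> RMod \<Longrightarrow> prec A B \<longleftrightarrow> le_Sigma lam \<Sigma> A B"
    using assms(2) unfolding E_nice_def by metis
  have inf: "infinite (Field lam)" using lam(2) by (simp add: cinfinite_def)
  have "lam =o |Field lam|"
    using lam(1) card_of_Field_ordIso ordIso_symmetric unfolding small_cardinal_def by blast
  then have R: "|UNIV :: 'r set| \<le>o |Field lam|" by (rule ordLeq_ordIso_trans[OF lam(3)])
  interpret aec mod_lang K ?prec by (fact assms(4))
  interpret submodule_closed_E_nice_aec K prec lam \<Sigma> by unfold_locales (fact nice inf R assms(3) assms(5))+
  let ?LS = "LS mod_lang K ?prec"
  have LS: "small_cardinal ?LS"
    using LS_bound_LS by (simp add: LS_bound_def)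
  \<comment> \<open>Stability is shown in \<open>2\<^sup>X\<close>, where \<open>X\<close> is above \<open>\<kappa>\<close>, \<open>2\<^sup>\<lambda>\<close> and the Loewenheim-Skolem number.\<close>
  define X where "X = Field \<kappa> <+> Pow (Field lam) <+> Field ?LS"
  have X\<kappa>: "|Field \<kappa>| \<le>o |X|" unfolding X_def by (rule card_of_Plus1)
  have XT: "|Pow (Field lam)| \<le>o |X|" unfolding X_def
    by (rule ordLeq_transitive[OF card_of_Plus1 card_of_Plus2])
  have XLS: "|Field ?LS| \<le>o |X|" unfolding X_def
    by (rule ordLeq_transitive[OF card_of_Plus2 card_of_Plus2])
  note infU = universe_infinite[OF assms(1)]
  have "|X| <o |?U|"
    unfolding X_def
    by (intro card_of_Plus_ordLess_infinite[OF infU] small_cardinal_Field \<kappa> LS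
        universe_powerset[OF assms(1)] lam(1))
  then have PU: "|Pow X| <o |?U|" by (rule universe_powerset[OF assms(1)])
  obtain g where g: "inj_on g (Pow X)" "g ` Pow X \<subseteq> ?U"
    using card_of_ordLeq[of "Pow X" ?U] ordLess_imp_ordLeq[OF PU] by blast
  define \<mu> where "\<mu> = |g ` Pow X|"
  have \<mu>: "\<mu> =o |Pow X|"
    unfolding \<mu>_def using card_of_ordIso[of "Pow X" "g ` Pow X"] g(1) ordIso_symmetric
    by (metis inj_on_imp_bij_betw)
  have le: "\<nu> \<le>o \<mu>" if "small_cardinal \<nu>" "|Field \<nu>| \<le>o |X|" for \<nu> :: "'u rel"
  proof -
    have "\<nu> =o |Field \<nu>|"
      using that(1) card_of_Field_ordIso ordIso_symmetric unfolding small_cardinal_def by blast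
    then have "\<nu> \<le>o |X|" using that(2) by (rule ordIso_ordLeq_trans)
    then have "\<nu> \<le>o |Pow X|" using ordLess_imp_ordLeq[OF card_of_Pow] by (rule ordLeq_transitive)
    then show ?thesis using ordIso_symmetric[OF \<mu>] by (rule ordLeq_ordIso_trans)
  qed
  have "small_cardinal \<mu>"
    using ordIso_ordLess_trans[OF \<mu> PU] card_of_Card_order unfolding small_cardinal_def \<mu>_def by simp
  moreover have "|galois_types mod_lang K ?prec A| \<le>o \<mu>" if "|carr A| =o \<mu>" for A
  proof -
    have "|carr A| \<le>o |Pow X|" by (rule ordIso_imp_ordLeq[OF ordIso_transitive[OF that \<mu>]])
    then have "|galois_types mod_lang K ?prec A| \<le>o |Pow X|"
      using few_Galois_types[OF XT] by blast
    then show ?thesis using ordIso_symmetric[OF \<mu>] by (rule ordLeq_ordIso_trans)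
  qed
  ultimately have "stable_in mod_lang K ?prec \<mu>"
    unfolding stable_in_def using le[OF LS XLS] by blast
  then show "\<exists>\<mu>. \<kappa> \<le>o \<mu> \<and> stable_in mod_lang K ?prec \<mu>" using le[OF \<kappa> X\<kappa>] by blast
qed

end
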